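(* Every order-enriched category with weighted limits and a regular cogenerator has weighted colimits.
   Context: $\mathsf{Pos}$ is the category of posets and monotone maps. An order-enriched category is a (locally small) category whose hom-sets are posets and whose composition is monotone in each variable; an order-enriched functor is one which is monotone on hom-posets. Weighted limits: let $\mathsf{D}$ be a small order-enriched category and $D:\mathsf{D}\to\mathsf{A}$, $W:\mathsf{D}\to\mathsf{Pos}$ order-enriched functors. A limit of $D$ weighted by $W$ is an object $L$ with a family of morphisms $l_d^x:L\to Dd$ ($d\in\mathsf{D}$, $x\in Wd$) such that (a) $l_d^x\le l_d^y$ whenever $x\le y$ in $Wd$, and $Dn\cdot l_d^x=l_{d'}^{Wn(x)}$ for all $n:d\to d'$ in $\mathsf{D}$ and $x\in Wd$; (b) every family $a_d^x:A\to Dd$ satisfying the analogue of (a) is of the form $a_d^x=l_d^x\cdot t$ for a unique $t:A\to L$, and for $t,t':A\to L$, if $l_d^x\cdot t\le l_d^x\cdot t'$ for all $d,x$, then $t\le t'$. The category $\mathsf{A}$ has weighted limits if all of these exist. Weighted colimits in $\mathsf{A}$ are weighted limits in $\mathsf{A}^{\mathrm{op}}$ (with the same order on hom-sets). Cotensor product: for a poset $I$ and an object $S$ of $\mathsf{A}$, $\pitchfork(I,S)$ is the weighted limit with $\mathsf{D}$ the unit category, $D$ picking $S$ and $W$ picking $I$; it has projections $\pi_i:\pitchfork(I,S)\to S$ ($i\in I$) with $\pi_i\le\pi_j$ for $i\le j$, universal as in (b). Regular cogenerator: let $\mathsf{A}$ be an order-enriched category with weighted limits and $S$ an object. For $X\in\mathsf{A}$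 put $\hat X=\pitchfork(\mathsf{A}(X,S),S)$ with projections $\pi_f$, $f\in\mathsf{A}(X,S)$, and let $n_X:X\to\hat X$ be the unique morphism with $\pi_f\cdot n_X=f$ for all $f\in\mathsf{A}(X,S)$. Let $\hat\pi_g$, $g\in\mathsf{A}(\hat X,S)$, be the projections of $\pitchfork(\mathsf{A}(\hat X,S),S)$, let $\alpha=n_{\hat X}:\hat X\to \pitchfork(\mathsf{A}(\hat X,S),S)$ (so $\hat\pi_g\cdot\alpha=g$), and let $\beta:\hat X\to \pitchfork(\mathsf{A}(\hat X,S),S)$ be the unique morphism with $\hat\pi_g\cdot\beta=\pi_{g\cdot n_X}$ for all $g$. The object $S$ is a regular cogenerator of $\mathsf{A}$ if, for every $X\in\mathsf{A}$, $n_X$ is an equaliser of $\alpha$ and $\beta$. *)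

theory Defs
  imports Main
begin

unbundle cardinal_syntax

section \<open>Smallness\<close>

text \<open>
  HOL has no built-in distinction between sets and classes.  Smallness is taken relative to an
  infinite regular strong limit cardinal \<open>\<kappa>\<close>: a set of any type is small if it has fewer than
  \<open>\<kappa>\<close> elements.  For uncountable \<open>\<kappa>\<close>, that is, for strongly inaccessible \<open>\<kappa>\<close>, this is
  smallness in the sense of the Grothendieck universe determined by \<open>\<kappa>\<close>.  Uncountability is not
  required, so that \<open>\<kappa> = natLeq\<close> (small = finite) is an instance.
\<close>

definition universe_cardinal :: "'u rel \<Rightarrow> bool" where
  "universe_cardinal \<kappa> \<longleftrightarrow>
     Cinfinite \<kappa> \<and> regularCard \<kappa> \<and> (\<forall>X :: 'u set. |X| <o \<kappa> \<longrightarrow> |Pow X| <o \<kappa>)"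

definition small :: "'u rel \<Rightarrow> 'a set \<Rightarrow> bool" where
  "small \<kappa> X \<longleftrightarrow> |X| <o \<kappa>"

section \<open>Order-enriched categories and functors\<close>

text \<open>Only the values of the operations on objects, arrows, composable pairs and parallel pairs
  matter; \<open>g \<cdot>\<^bsub>C\<^esub> f\<close> is \<open>g\<close> after \<open>f\<close>.\<close>

record ('o, 'm) ordcat =
  Obj :: "'o set"
  Arr :: "'m set"
  Dom :: "'m \<Rightarrow> 'o"
  Cod :: "'m \<Rightarrow> 'o"
  Ident :: "'o \<Rightarrow> 'm"
  Comp :: "'m \<Rightarrow> 'm \<Rightarrow> 'm"  (infixl \<open>\<cdot>\<index>\<close> 70)
  Le :: "'m \<Rightarrow> 'm \<Rightarrow> bool"  (infix \<open>\<sqsubseteq>\<index>\<close> 50)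

definition Hom :: "('o, 'm) ordcat \<Rightarrow> 'o \<Rightarrow> 'o \<Rightarrow> 'm set" where
  "Hom C a b = {f \<in> Arr C. Dom C f = a \<and> Cod C f = b}"

definition hom_order :: "('o, 'm) ordcat \<Rightarrow> 'o \<Rightarrow> 'o \<Rightarrow> 'm rel" where
  "hom_order C a b = {(f, g). f \<in> Hom C a b \<and> g \<in> Hom C a b \<and> f \<sqsubseteq>\<^bsub>C\<^esub> g}"

text \<open>The axioms of an order-enriched category, without size conditions.\<close>

locale ord_category =
  fixes C :: "('o, 'm) ordcat" (structure)
  assumes Dom_Obj: "f \<in> Arr C \<Longrightarrow> Dom C f \<in> Obj C"
    and Cod_Obj: "f \<in> Arr C \<Longrightarrow> Cod C f \<in> Obj C"
    and Ident_Hom: "a \<in> Obj C \<Longrightarrow> Ident C a \<in> Hom C a a"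
    and Comp_Hom: "f \<in> Hom C a b \<Longrightarrow> g \<in> Hom C b c \<Longrightarrow> g \<cdot> f \<in> Hom C a c"
    and Comp_Ident: "f \<in> Hom C a b \<Longrightarrow> f \<cdot> Ident C a = f"
    and Ident_Comp: "f \<in> Hom C a b \<Longrightarrow> Ident C b \<cdot> f = f"
    and Comp_assoc: "f \<in> Hom C a b \<Longrightarrow> g \<in> Hom C b c \<Longrightarrow> h \<in> Hom C c d \<Longrightarrow>
           h \<cdot> (g \<cdot> f) = (h \<cdot> g) \<cdot> f"
    and Hom_poset: "a \<in> Obj C \<Longrightarrow> b \<in> Obj C \<Longrightarrow> partial_order_on (Hom C a b) (hom_order C a b)"
    and Comp_mono: "f \<in> Hom C a b \<Longrightarrow> f' \<in> Hom C a b \<Longrightarrow> g \<in> Hom C b c \<Longrightarrow> g' \<in> Hom C b c \<Longrightarrow>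
           f \<sqsubseteq> f' \<Longrightarrow> g \<sqsubseteq> g' \<Longrightarrow> g \<cdot> f \<sqsubseteq> g' \<cdot> f'"

definition order_enriched_category :: "'u rel \<Rightarrow> ('o, 'm) ordcat \<Rightarrow> bool" where
  "order_enriched_category \<kappa> C \<longleftrightarrow>
     ord_category C \<and> (\<forall>a\<in>Obj C. \<forall>b\<in>Obj C. small \<kappa> (Hom C a b))"

definition small_order_enriched_category :: "'u rel \<Rightarrow> ('o, 'm) ordcat \<Rightarrow> bool" where
  "small_order_enriched_category \<kappa> C \<longleftrightarrow> ord_category C \<and> small \<kappa> (Obj C) \<and> small \<kappa> (Arr C)"

definition op_cat :: "('o, 'm) ordcat \<Rightarrow> ('o, 'm) ordcat" where
  "op_cat C = \<lparr>Obj = Obj C, Arr = Arr C, Dom = Cod C, Cod = Dom C, Ident = Ident C,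
     Comp = (\<lambda>g f. f \<cdot>\<^bsub>C\<^esub> g), Le = Le C\<rparr>"

definition unit_cat :: "(unit, unit) ordcat" where
  "unit_cat = \<lparr>Obj = UNIV, Arr = UNIV, Dom = (\<lambda>_. ()), Cod = (\<lambda>_. ()), Ident = (\<lambda>_. ()),
     Comp = (\<lambda>_ _. ()), Le = (\<lambda>_ _. True)\<rparr>"

definition order_enriched_functor ::
  "('d, 'e) ordcat \<Rightarrow> ('o, 'm) ordcat \<Rightarrow> ('d \<Rightarrow> 'o) \<Rightarrow> ('e \<Rightarrow> 'm) \<Rightarrow> bool" where
  "order_enriched_functor D C F Fm \<longleftrightarrow>
     (\<forall>d\<in>Obj D. F d \<in> Obj C) \<and>
     (\<forall>d\<in>Obj D. \<forall>d'\<in>Obj D. \<forall>n\<in>Hom D d d'. Fm n \<in> Hom C (F d) (F d')) \<and>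
     (\<forall>d\<in>Obj D. Fm (Ident D d) = Ident C (F d)) \<and>
     (\<forall>d\<in>Obj D. \<forall>d'\<in>Obj D. \<forall>d''\<in>Obj D. \<forall>n\<in>Hom D d d'. \<forall>n'\<in>Hom D d' d''.
        Fm (n' \<cdot>\<^bsub>D\<^esub> n) = Fm n' \<cdot>\<^bsub>C\<^esub> Fm n) \<and>
     (\<forall>d\<in>Obj D. \<forall>d'\<in>Obj D. \<forall>n\<in>Hom D d d'. \<forall>n'\<in>Hom D d d'.
        n \<sqsubseteq>\<^bsub>D\<^esub> n' \<longrightarrow> Fm n \<sqsubseteq>\<^bsub>C\<^esub> Fm n')"

text \<open>
  Order-enriched functors from \<open>D\<close> to the category of posets and monotone maps (ordered pointwise).
  A poset is a relation \<open>r\<close> with \<open>Partial_order r\<close>, its underlying set being \<open>Field r\<close>; a monotone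
  map is a HOL function of which only the values on the underlying set are relevant.
\<close>

definition weight :: "('d, 'e) ordcat \<Rightarrow> ('d \<Rightarrow> 'x rel) \<Rightarrow> ('e \<Rightarrow> 'x \<Rightarrow> 'x) \<Rightarrow> bool" where
  "weight D W Wm \<longleftrightarrow>
     (\<forall>d\<in>Obj D. Partial_order (W d)) \<and>
     (\<forall>d\<in>Obj D. \<forall>d'\<in>Obj D. \<forall>n\<in>Hom D d d'. \<forall>(x, y)\<in>W d. (Wm n x, Wm n y) \<in> W d') \<and>
     (\<forall>d\<in>Obj D. \<forall>x\<in>Field (W d). Wm (Ident D d) x = x) \<and>
     (\<forall>d\<in>Obj D. \<forall>d'\<in>Obj D. \<forall>d''\<in>Obj D. \<forall>n\<in>Hom D d d'. \<forall>n'\<in>Hom D d' d''. \<forall>x\<in>Field (W d).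
        Wm (n' \<cdot>\<^bsub>D\<^esub> n) x = Wm n' (Wm n x)) \<and>
     (\<forall>d\<in>Obj D. \<forall>d'\<in>Obj D. \<forall>n\<in>Hom D d d'. \<forall>n'\<in>Hom D d d'. n \<sqsubseteq>\<^bsub>D\<^esub> n' \<longrightarrow>
        (\<forall>x\<in>Field (W d). (Wm n x, Wm n' x) \<in> W d'))"

section \<open>Weighted limits and colimits\<close>

definition weighted_cone ::
  "('o, 'm) ordcat \<Rightarrow> ('d, 'e) ordcat \<Rightarrow> ('d \<Rightarrow> 'o) \<Rightarrow> ('e \<Rightarrow> 'm) \<Rightarrow>
   ('d \<Rightarrow> 'x rel) \<Rightarrow> ('e \<Rightarrow> 'x \<Rightarrow> 'x) \<Rightarrow> 'o \<Rightarrow> ('d \<Rightarrow> 'x \<Rightarrow> 'm) \<Rightarrow> bool" where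
  "weighted_cone C D F Fm W Wm A a \<longleftrightarrow>
     A \<in> Obj C \<and>
     (\<forall>d\<in>Obj D. \<forall>x\<in>Field (W d). a d x \<in> Hom C A (F d)) \<and>
     (\<forall>d\<in>Obj D. \<forall>(x, y)\<in>W d. a d x \<sqsubseteq>\<^bsub>C\<^esub> a d y) \<and>
     (\<forall>d\<in>Obj D. \<forall>d'\<in>Obj D. \<forall>n\<in>Hom D d d'. \<forall>x\<in>Field (W d).
        Fm n \<cdot>\<^bsub>C\<^esub> a d x = a d' (Wm n x))"

definition is_weighted_limit ::
  "('o, 'm) ordcat \<Rightarrow> ('d, 'e) ordcat \<Rightarrow> ('d \<Rightarrow> 'o) \<Rightarrow> ('e \<Rightarrow> 'm) \<Rightarrow>
   ('d \<Rightarrow> 'x rel) \<Rightarrow> ('e \<Rightarrow> 'x \<Rightarrow> 'x) \<Rightarrow> 'o \<Rightarrow> ('d \<Rightarrow> 'x \<Rightarrow> 'm) \<Rightarrow> bool" where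
  "is_weighted_limit C D F Fm W Wm L l \<longleftrightarrow>
     weighted_cone C D F Fm W Wm L l \<and>
     (\<forall>A a. weighted_cone C D F Fm W Wm A a \<longrightarrow>
        (\<exists>!t. t \<in> Hom C A L \<and> (\<forall>d\<in>Obj D. \<forall>x\<in>Field (W d). a d x = l d x \<cdot>\<^bsub>C\<^esub> t))) \<and>
     (\<forall>A\<in>Obj C. \<forall>t\<in>Hom C A L. \<forall>t'\<in>Hom C A L.
        (\<forall>d\<in>Obj D. \<forall>x\<in>Field (W d). l d x \<cdot>\<^bsub>C\<^esub> t \<sqsubseteq>\<^bsub>C\<^esub> l d x \<cdot>\<^bsub>C\<^esub> t') \<longrightarrow> t \<sqsubseteq>\<^bsub>C\<^esub> t')"

text \<open>
  The small diagram categories and the small posets \<open>W d\<close> range over those with elements in the type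
  \<open>'u\<close> that carries \<open>\<kappa>\<close>.  Every small set of any type is equipotent to a subset of \<open>'u\<close>, so all
  small diagrams and weights are covered up to isomorphism.
\<close>

definition has_weighted_limits :: "'u rel \<Rightarrow> ('o, 'm) ordcat \<Rightarrow> bool" where
  "has_weighted_limits \<kappa> C \<longleftrightarrow>
     (\<forall>(D :: ('u, 'u) ordcat) F Fm (W :: 'u \<Rightarrow> 'u rel) Wm.
        small_order_enriched_category \<kappa> D \<and> order_enriched_functor D C F Fm \<and>
        weight D W Wm \<and> (\<forall>d\<in>Obj D. small \<kappa> (Field (W d))) \<longrightarrow>
        (\<exists>L l. is_weighted_limit C D F Fm W Wm L l))"

definition has_weighted_colimits :: "'u rel \<Rightarrow> ('o, 'm) ordcat \<Rightarrow> bool" where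
  "has_weighted_colimits \<kappa> C \<longleftrightarrow> has_weighted_limits \<kappa> (op_cat C)"

section \<open>Cotensor products and regular cogenerators\<close>

definition is_cotensor ::
  "('o, 'm) ordcat \<Rightarrow> 'x rel \<Rightarrow> 'o \<Rightarrow> 'o \<Rightarrow> ('x \<Rightarrow> 'm) \<Rightarrow> bool" where
  "is_cotensor C I S P \<pi> \<longleftrightarrow>
     is_weighted_limit C unit_cat (\<lambda>_. S) (\<lambda>_. Ident C S) (\<lambda>_. I) (\<lambda>_ x. x) P (\<lambda>_. \<pi>)"

text \<open>The equaliser in the underlying ordinary category.  If \<open>C\<close> has weighted limits, then it also
  has the two-dimensional universal property: by uniqueness up to isomorphism it coincides with the
  weighted limit of the parallel pair with constant weight the one-element poset.\<close>

definition is_equaliser ::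
  "('o, 'm) ordcat \<Rightarrow> 'o \<Rightarrow> 'o \<Rightarrow> 'o \<Rightarrow> 'm \<Rightarrow> 'm \<Rightarrow> 'm \<Rightarrow> bool" where
  "is_equaliser C E X Y e \<alpha> \<beta> \<longleftrightarrow>
     \<alpha> \<in> Hom C X Y \<and> \<beta> \<in> Hom C X Y \<and> e \<in> Hom C E X \<and> \<alpha> \<cdot>\<^bsub>C\<^esub> e = \<beta> \<cdot>\<^bsub>C\<^esub> e \<and>
     (\<forall>A\<in>Obj C. \<forall>h\<in>Hom C A X. \<alpha> \<cdot>\<^bsub>C\<^esub> h = \<beta> \<cdot>\<^bsub>C\<^esub> h \<longrightarrow> (\<exists>!t. t \<in> Hom C A E \<and> e \<cdot>\<^bsub>C\<^esub> t = h))"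

text \<open>
  Here \<open>\<pi>\<close> and \<open>\<rho>\<close> are the projections of \<open>Xh\<close>, the cotensor of \<open>S\<close> by the poset \<open>Hom C X S\<close>, and of
  \<open>Y\<close>, the cotensor of \<open>S\<close> by the poset \<open>Hom C Xh S\<close>.  Cotensors are unique up to isomorphism, and
  \<open>n\<close>, \<open>\<alpha>\<close>, \<open>\<beta>\<close> are uniquely determined by the equations, so the existential quantifier
  only selects representatives.
\<close>

definition regular_cogenerator :: "('o, 'm) ordcat \<Rightarrow> 'o \<Rightarrow> bool" where
  "regular_cogenerator C S \<longleftrightarrow>
     S \<in> Obj C \<and>
     (\<forall>X\<in>Obj C. \<exists>Xh \<pi> Y \<rho> n \<alpha> \<beta>.
        is_cotensor C (hom_order C X S) S Xh \<pi> \<and>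
        is_cotensor C (hom_order C Xh S) S Y \<rho> \<and>
        n \<in> Hom C X Xh \<and> (\<forall>f\<in>Hom C X S. \<pi> f \<cdot>\<^bsub>C\<^esub> n = f) \<and>
        \<alpha> \<in> Hom C Xh Y \<and> (\<forall>g\<in>Hom C Xh S. \<rho> g \<cdot>\<^bsub>C\<^esub> \<alpha> = g) \<and>
        \<beta> \<in> Hom C Xh Y \<and> (\<forall>g\<in>Hom C Xh S. \<rho> g \<cdot>\<^bsub>C\<^esub> \<beta> = \<pi> (g \<cdot>\<^bsub>C\<^esub> n)) \<and>
        is_equaliser C X Xh Y n \<alpha> \<beta>)"

end

theory Submission
  imports Defs
begin

text \<open>
  Write \<open>S\<close> for the regular cogenerator. The colimit \<open>L\<close> must satisfy \<open>Hom L S \<cong> P\<close>, where \<open>P\<close> is the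
  small poset of cocones with vertex \<open>S\<close>. Let \<open>Q\<close> be the cotensor of \<open>S\<close> by \<open>P\<close>, with projections \<open>\<iota> p\<close>
  and canonical cocone \<open>q\<close>, so that \<open>\<iota> p \<cdot> q d x = p d x\<close>. Every \<open>g : Q \<rightarrow> S\<close> yields a second morphism
  \<open>\<iota> (g \<cdot> q)\<close> with the same restriction to the cocone, and \<open>c : L \<rightarrow> Q\<close> is the universal morphism
  identifying \<open>g\<close> with \<open>\<iota> (g \<cdot> q)\<close> for all \<open>g\<close>; hence \<open>q = c \<cdot> l\<close> for a cocone \<open>l\<close> on \<open>L\<close>.

  For a cocone \<open>a\<close> on \<open>A\<close>, the morphism \<open>L \<rightarrow> \<pitchfork>(Hom A S, S)\<close> with components \<open>\<iota> (s \<cdot> a) \<cdot> c\<close> satisfies the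
  equations defining the equaliser \<open>n_A\<close>, so it factors through some \<open>t : L \<rightarrow> A\<close> with \<open>t \<cdot> l = a\<close> and
  \<open>s \<cdot> t = \<iota> (s \<cdot> a) \<cdot> c\<close>. Applied to \<open>a = l\<close> this gives an endomorphism of \<open>L\<close> fixed by \<open>c\<close>, that is,
  the identity; so \<open>s = \<iota> (s \<cdot> l) \<cdot> c\<close> for all \<open>s : L \<rightarrow> S\<close>, which is the order part of the universal
  property for \<open>S\<close>, and it extends to all \<open>A\<close> because \<open>n_A\<close> reflects the order.
\<close>

section \<open>Small sets\<close>

lemma small_subset: "small \<kappa> B \<Longrightarrow> A \<subseteq> B \<Longrightarrow> small \<kappa> A"
  unfolding small_def by (metis card_of_mono1 ordLeq_ordLess_trans)

lemma small_image: "small \<kappa> A \<Longrightarrow> small \<kappa> (f ` A)"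
  unfolding small_def by (metis card_of_image ordLeq_ordLess_trans)

lemma small_inj_on: "inj_on f A \<Longrightarrow> small \<kappa> (f ` A) \<Longrightarrow> small \<kappa> A"
  by (metis inv_into_image_cancel order_refl small_image)

text \<open>A cardinal below \<open>\<kappa>\<close> embeds into \<open>Field \<kappa>\<close>, a
  subset of the type \<open>'u\<close>. This is how small posets of arbitrary type are transported
  to \<open>'u\<close>, the only type over which \<open>has_weighted_limits\<close>
  quantifies.\<close>

lemma small_imp_inj:
  fixes \<kappa> :: "'u rel" and A :: "'a set"
  assumes \<kappa>: "universe_cardinal \<kappa>" and A: "small \<kappa> A"
  obtains f :: "'a \<Rightarrow> 'u" where "inj_on f A"
proof -
  have "|Field \<kappa>| =o \<kappa>"
    using \<kappa> card_of_Field_ordIso unfolding universe_cardinal_def by blast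
  then have "|A| <o |Field \<kappa>|"
    using A ordIso_symmetric ordLess_ordIso_trans unfolding small_def by blast
  then have "|A| \<le>o |Field \<kappa>|"
    by (rule ordLess_imp_ordLeq)
  then show thesis
    using that by (auto simp: card_of_ordLeq[symmetric])
qed

text \<open>The strong limit axiom speaks of subsets of \<open>'u\<close> only; an injection into
  \<open>'u\<close> carries it over to every type.\<close>

lemma small_Pow:
  fixes \<kappa> :: "'u rel" and A :: "'a set"
  assumes \<kappa>: "universe_cardinal \<kappa>" and A: "small \<kappa> A"
  shows "small \<kappa> (Pow A)"
proof -
  obtain f :: "'a \<Rightarrow> 'u" where f: "inj_on f A"
    using small_imp_inj[OF \<kappa> A] .
  have "small \<kappa> (Pow (f ` A))"
    using \<kappa> small_image[OF A, of f] unfolding universe_cardinal_def small_def by blast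
  then have "small \<kappa> (image f ` Pow A)"
    by (rule small_subset) auto
  then show ?thesis
    using small_inj_on inj_on_image_Pow[OF f] by blast
qed

lemma small_UNION:
  assumes "universe_cardinal \<kappa>" "small \<kappa> I" "\<And>i. i \<in> I \<Longrightarrow> small \<kappa> (A i)"
  shows "small \<kappa> (\<Union>i\<in>I. A i)"
  using assms regularCard_UNION_bound unfolding universe_cardinal_def small_def by blast

lemma small_Sigma:
  assumes "universe_cardinal \<kappa>" "small \<kappa> I" "\<And>i. i \<in> I \<Longrightarrow> small \<kappa> (A i)"
  shows "small \<kappa> (Sigma I A)"
proof -
  have "Sigma I A = (\<Union>i\<in>I. Pair i ` A i)"
    by auto
  then show ?thesis
    using small_UNION[OF assms(1,2)] small_image[OF assms(3)] by (metis (no_types, lifting))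
qed

lemma small_finite:
  assumes "universe_cardinal \<kappa>" "finite A"
  shows "small \<kappa> A"
  using assms finite_ordLess_infinite[OF card_of_Well_order, of \<kappa> A]
  unfolding universe_cardinal_def small_def cinfinite_def
  by (auto simp: Field_card_of card_order_on_well_order_on)

text \<open>Supplies enough distinct elements of \<open>'u\<close> to build the shape of a parallel
  pair there.\<close>

lemma infinite_universe:
  fixes \<kappa> :: "'u rel"
  assumes "universe_cardinal \<kappa>"
  shows "infinite (UNIV :: 'u set)"
  using assms finite_subset[OF subset_UNIV] unfolding universe_cardinal_def cinfinite_def by blast

section \<open>Order-enriched categories\<close>

context ord_category
begin

lemma Hom_Obj: "f \<in> Hom C a b \<Longrightarrow> a \<in> Obj C" "f \<in> Hom C a b \<Longrightarrow> b \<in> Obj C"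
  using Dom_Obj Cod_Obj unfolding Hom_def by auto

lemma le_refl: "f \<in> Hom C a b \<Longrightarrow> f \<sqsubseteq> f"
  using Hom_poset[of a b] Hom_Obj[of f a b]
  unfolding partial_order_on_def preorder_on_def refl_on_def hom_order_def by auto

lemma le_trans:
  "f \<in> Hom C a b \<Longrightarrow> g \<in> Hom C a b \<Longrightarrow> h \<in> Hom C a b \<Longrightarrow> f \<sqsubseteq> g \<Longrightarrow> g \<sqsubseteq> h \<Longrightarrow> f \<sqsubseteq> h"
  using Hom_poset[of a b] Hom_Obj[of f a b]
  unfolding partial_order_on_def preorder_on_def trans_def hom_order_def by blast

lemma le_antisym:
  "f \<in> Hom C a b \<Longrightarrow> g \<in> Hom C a b \<Longrightarrow> f \<sqsubseteq> g \<Longrightarrow> g \<sqsubseteq> f \<Longrightarrow> f = g"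
  using Hom_poset[of a b] Hom_Obj[of f a b]
  unfolding partial_order_on_def antisym_def hom_order_def by blast

lemma Comp_mono_left:
  "f \<in> Hom C a b \<Longrightarrow> g \<in> Hom C b c \<Longrightarrow> g' \<in> Hom C b c \<Longrightarrow> g \<sqsubseteq> g' \<Longrightarrow> g \<cdot> f \<sqsubseteq> g' \<cdot> f"
  using Comp_mono le_refl by blast

lemma Comp_mono_right:
  "f \<in> Hom C a b \<Longrightarrow> f' \<in> Hom C a b \<Longrightarrow> g \<in> Hom C b c \<Longrightarrow> f \<sqsubseteq> f' \<Longrightarrow> g \<cdot> f \<sqsubseteq> g \<cdot> f'"
  using Comp_mono le_refl by blast

lemma order_monic_imp_monic:
  assumes m: "m \<in> Hom C X Y"
    and mono: "\<And>u u'. u \<in> Hom C A X \<Longrightarrow> u' \<in> Hom C A X \<Longrightarrow> m \<cdot> u \<sqsubseteq> m \<cdot> u' \<Longrightarrow> u \<sqsubseteq> u'"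
    and t: "t \<in> Hom C A X" "t' \<in> Hom C A X" and eq: "m \<cdot> t = m \<cdot> t'"
  shows "t = t'"
  using le_antisym[OF t] mono[OF t] mono[OF t(2,1)] le_refl[OF Comp_Hom[OF t(2) m]] eq by simp

lemma Field_hom_order: "Field (hom_order C a b) = Hom C a b"
  using le_refl unfolding Field_def hom_order_def by blast

text \<open>Lets the limit criterion \<open>is_weighted_limitI\<close> be applied to
  colimits.\<close>

lemma ord_category_op_cat: "ord_category (op_cat C)"
proof -
  have H: "Hom (op_cat C) a b = Hom C b a" for a b
    unfolding Hom_def op_cat_def by auto
  have R: "hom_order (op_cat C) a b = hom_order C b a" for a b
    unfolding hom_order_def H by (simp add: op_cat_def)
  have simps: "Obj (op_cat C) = Obj C" "Arr (op_cat C) = Arr C" "Dom (op_cat C) = Cod C"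
    "Cod (op_cat C) = Dom C" "Ident (op_cat C) = Ident C" "Le (op_cat C) = Le C"
    "Comp (op_cat C) g f = f \<cdot> g" for g f
    unfolding op_cat_def by auto
  show ?thesis
    by (unfold_locales; unfold H R simps)
      (simp_all add: Dom_Obj Cod_Obj Ident_Hom Comp_Hom Comp_Ident Ident_Comp Comp_assoc Hom_poset Comp_mono)
qed

text \<open>The order clause \<open>mono\<close>, used in both directions, yields uniqueness of
  factorisations by antisymmetry, so only their existence remains to be supplied.\<close>

lemma is_weighted_limitI:
  assumes cone: "weighted_cone C D F Fm W Wm L l"
    and ex: "\<And>A a. weighted_cone C D F Fm W Wm A a \<Longrightarrow>
      \<exists>t\<in>Hom C A L. \<forall>d\<in>Obj D. \<forall>x\<in>Field (W d). a d x = l d x \<cdot> t"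
    and mono: "\<And>A t t'. t \<in> Hom C A L \<Longrightarrow> t' \<in> Hom C A L \<Longrightarrow>
      (\<And>d x. d \<in> Obj D \<Longrightarrow> x \<in> Field (W d) \<Longrightarrow> l d x \<cdot> t \<sqsubseteq> l d x \<cdot> t') \<Longrightarrow> t \<sqsubseteq> t'"
  shows "is_weighted_limit C D F Fm W Wm L l"
proof -
  have l: "l d x \<in> Hom C L (F d)" if "d \<in> Obj D" "x \<in> Field (W d)" for d x
    using cone that unfolding weighted_cone_def by blast
  have uniq: "t = t'"
    if t: "t \<in> Hom C A L" "t' \<in> Hom C A L"
      and eq: "\<And>d x. d \<in> Obj D \<Longrightarrow> x \<in> Field (W d) \<Longrightarrow> l d x \<cdot> t = l d x \<cdot> t'" for A t t'
  proof (rule le_antisym[OF t])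
    show "t \<sqsubseteq> t'" by (rule mono[OF t]) (metis eq le_refl Comp_Hom l t(2))
    show "t' \<sqsubseteq> t" by (rule mono[OF t(2,1)]) (metis eq le_refl Comp_Hom l t(2))
  qed
  show ?thesis
    unfolding is_weighted_limit_def
  proof (intro conjI allI impI ballI)
    fix A a assume "weighted_cone C D F Fm W Wm A a"
    then obtain t where t: "t \<in> Hom C A L" "\<forall>d\<in>Obj D. \<forall>x\<in>Field (W d). a d x = l d x \<cdot> t"
      using ex by blast
    show "\<exists>!t. t \<in> Hom C A L \<and> (\<forall>d\<in>Obj D. \<forall>x\<in>Field (W d). a d x = l d x \<cdot> t)"
    proof (rule ex1I)
      show "t \<in> Hom C A L \<and> (\<forall>d\<in>Obj D. \<forall>x\<in>Field (W d). a d x = l d x \<cdot> t)"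
        using t by blast
    next
      fix s assume "s \<in> Hom C A L \<and> (\<forall>d\<in>Obj D. \<forall>x\<in>Field (W d). a d x = l d x \<cdot> s)"
      then show "s = t"
        by (intro uniq[of s A t]) (use t in auto)
    qed
  qed (use cone mono in blast)+
qed

section \<open>Cotensors and equalisers\<close>

lemma unit_cat_simps: "Obj unit_cat = UNIV" "Hom unit_cat u v = UNIV"
  unfolding unit_cat_def Hom_def by auto

lemma weighted_cone_unit_cat_iff:
  "weighted_cone C unit_cat (\<lambda>_. S) (\<lambda>_. Ident C S) (\<lambda>_. I) (\<lambda>_ x. x) A (\<lambda>_. a) \<longleftrightarrow>
    A \<in> Obj C \<and> (\<forall>i\<in>Field I. a i \<in> Hom C A S) \<and> (\<forall>(i, j)\<in>I. a i \<sqsubseteq> a j)"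
  unfolding weighted_cone_def unit_cat_simps using Ident_Comp by auto

text \<open>The working form of the definition: the unit category disappears, and unique existence
  becomes existence because the order clause forces uniqueness.\<close>

lemma is_cotensor_iff:
  "is_cotensor C I S P \<pi> \<longleftrightarrow>
    P \<in> Obj C \<and> (\<forall>i\<in>Field I. \<pi> i \<in> Hom C P S) \<and> (\<forall>(i, j)\<in>I. \<pi> i \<sqsubseteq> \<pi> j) \<and>
    (\<forall>A\<in>Obj C. \<forall>a. (\<forall>i\<in>Field I. a i \<in> Hom C A S) \<and> (\<forall>(i, j)\<in>I. a i \<sqsubseteq> a j) \<longrightarrow>
      (\<exists>t\<in>Hom C A P. \<forall>i\<in>Field I. a i = \<pi> i \<cdot> t)) \<and>
    (\<forall>A. \<forall>t\<in>Hom C A P. \<forall>t'\<in>Hom C A P. (\<forall>i\<in>Field I. \<pi> i \<cdot> t \<sqsubseteq> \<pi> i \<cdot> t') \<longrightarrow> t \<sqsubseteq> t')"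
    (is "_ \<longleftrightarrow> ?R")
proof
  assume l: "is_cotensor C I S P \<pi>"
  note L = l[unfolded is_cotensor_def is_weighted_limit_def]
  have "\<exists>t\<in>Hom C A P. \<forall>i\<in>Field I. a i = \<pi> i \<cdot> t"
    if "A \<in> Obj C" "\<forall>i\<in>Field I. a i \<in> Hom C A S" "\<forall>(i, j)\<in>I. a i \<sqsubseteq> a j" for A a
    using L[THEN conjunct2, THEN conjunct1, rule_format, of A "\<lambda>_. a"] that
    unfolding weighted_cone_unit_cat_iff unit_cat_simps by auto
  moreover have "t \<sqsubseteq> t'"
    if "t \<in> Hom C A P" "t' \<in> Hom C A P" "\<forall>i\<in>Field I. \<pi> i \<cdot> t \<sqsubseteq> \<pi> i \<cdot> t'" for A t t'
    using L[THEN conjunct2, THEN conjunct2] that Hom_Obj(1)[OF that(1)] by blast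
  ultimately show ?R
    using L[THEN conjunct1, unfolded weighted_cone_unit_cat_iff] by auto
next
  assume R: ?R
  show "is_cotensor C I S P \<pi>"
    unfolding is_cotensor_def
  proof (rule is_weighted_limitI)
    show "weighted_cone C unit_cat (\<lambda>_. S) (\<lambda>_. Ident C S) (\<lambda>_. I) (\<lambda>_ x. x) P (\<lambda>_. \<pi>)"
      unfolding weighted_cone_unit_cat_iff using R by blast
  next
    fix A and a :: "unit \<Rightarrow> _"
    assume a: "weighted_cone C unit_cat (\<lambda>_. S) (\<lambda>_. Ident C S) (\<lambda>_. I) (\<lambda>_ x. x) A a"
    \<comment> \<open>A function on \<open>unit\<close> is constant, which brings the cone into the
      shape treated by \<open>weighted_cone_unit_cat_iff\<close>.\<close>
    have "a = (\<lambda>_. a ())" by auto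
    with a have "weighted_cone C unit_cat (\<lambda>_. S) (\<lambda>_. Ident C S) (\<lambda>_. I) (\<lambda>_ x. x) A (\<lambda>_. a ())"
      by metis
    then show "\<exists>t\<in>Hom C A P. \<forall>d\<in>Obj unit_cat. \<forall>x\<in>Field I. a d x = \<pi> x \<cdot> t"
      unfolding weighted_cone_unit_cat_iff unit_cat_simps using R by simp
  next
    fix A t t' assume "t \<in> Hom C A P" "t' \<in> Hom C A P"
      "\<And>d x. d \<in> Obj unit_cat \<Longrightarrow> x \<in> Field I \<Longrightarrow> \<pi> x \<cdot> t \<sqsubseteq> \<pi> x \<cdot> t'"
    then show "t \<sqsubseteq> t'" unfolding unit_cat_simps using R by blast
  qed
qed

lemma cotensor_Obj: "is_cotensor C I S P \<pi> \<Longrightarrow> P \<in> Obj C"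
  and cotensor_proj_Hom: "is_cotensor C I S P \<pi> \<Longrightarrow> i \<in> Field I \<Longrightarrow> \<pi> i \<in> Hom C P S"
  and cotensor_proj_mono: "is_cotensor C I S P \<pi> \<Longrightarrow> (i, j) \<in> I \<Longrightarrow> \<pi> i \<sqsubseteq> \<pi> j"
  unfolding is_cotensor_iff by auto

lemma cotensor_lift:
  assumes "is_cotensor C I S P \<pi>" "A \<in> Obj C"
    and "\<And>i. i \<in> Field I \<Longrightarrow> a i \<in> Hom C A S" "\<And>i j. (i, j) \<in> I \<Longrightarrow> a i \<sqsubseteq> a j"
  obtains t where "t \<in> Hom C A P" "\<And>i. i \<in> Field I \<Longrightarrow> \<pi> i \<cdot> t = a i"
proof -
  have "\<exists>t\<in>Hom C A P. \<forall>i\<in>Field I. a i = \<pi> i \<cdot> t"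
    using assms(1)[unfolded is_cotensor_iff, THEN conjunct2, THEN conjunct2, THEN conjunct2,
        THEN conjunct1, rule_format, OF assms(2), of a] assms(3,4) by auto
  then obtain t where "t \<in> Hom C A P" "\<forall>i\<in>Field I. a i = \<pi> i \<cdot> t"
    by blast
  then show thesis
    using that[of t] by simp
qed

lemma cotensor_le:
  assumes "is_cotensor C I S P \<pi>" "t \<in> Hom C A P" "t' \<in> Hom C A P"
    and "\<And>i. i \<in> Field I \<Longrightarrow> \<pi> i \<cdot> t \<sqsubseteq> \<pi> i \<cdot> t'"
  shows "t \<sqsubseteq> t'"
  using assms unfolding is_cotensor_iff by blast

lemma cotensor_eq:
  assumes P: "is_cotensor C I S P \<pi>" and t: "t \<in> Hom C A P" "t' \<in> Hom C A P"
    and eq: "\<And>i. i \<in> Field I \<Longrightarrow> \<pi> i \<cdot> t = \<pi> i \<cdot> t'"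
  shows "t = t'"
proof (rule le_antisym[OF t])
  have le: "\<pi> i \<cdot> t' \<sqsubseteq> \<pi> i \<cdot> t'" if "i \<in> Field I" for i
    using le_refl[OF Comp_Hom[OF t(2) cotensor_proj_Hom[OF P that]]] .
  show "t \<sqsubseteq> t'"
    by (rule cotensor_le[OF P t]) (simp add: eq le)
  show "t' \<sqsubseteq> t"
    by (rule cotensor_le[OF P t(2,1)]) (simp add: eq le)
qed

text \<open>The assumed limits have shapes and weights over \<open>'u\<close>, whereas the index
  posets used below consist of morphisms or cocones. Both the poset and the unit category are
  therefore copied into \<open>'u\<close>, and the resulting limit is reindexed along the injection
  \<open>f\<close>.\<close>

lemma has_cotensors:
  fixes \<kappa> :: "'u rel" and I :: "'x rel"
  assumes \<kappa>: "universe_cardinal \<kappa>" and lim: "has_weighted_limits \<kappa> C"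
    and S: "S \<in> Obj C" and I: "Partial_order I" and small: "small \<kappa> (Field I)"
  obtains P \<pi> where "is_cotensor C I S P \<pi>"
proof -
  obtain f :: "'x \<Rightarrow> 'u" where f: "inj_on f (Field I)"
    using small_imp_inj[OF \<kappa> small] .
  define J where "J = map_prod f f ` I"
  have FJ: "Field J = f ` Field I"
    unfolding J_def Field_def by force
  have J_iff: "(x, y) \<in> J \<longleftrightarrow> (\<exists>i j. x = f i \<and> y = f j \<and> (i, j) \<in> I)" for x y
    unfolding J_def by auto
  have J: "Partial_order J"
    unfolding partial_order_on_def preorder_on_def
  proof (intro conjI)
    show "J \<subseteq> Field J \<times> Field J"
      by (auto simp: Field_def)
    show "refl_on (Field J) J"
      using I unfolding FJ refl_on_def partial_order_on_def preorder_on_def J_iff by blast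
    show "trans J"
    proof (rule transI)
      fix x y z assume "(x, y) \<in> J" "(y, z) \<in> J"
      then obtain i j j' k where ijk: "x = f i" "y = f j" "y = f j'" "z = f k" "(i, j) \<in> I" "(j', k) \<in> I"
        unfolding J_iff by blast
      then have "j = j'"
        using f by (metis FieldI1 FieldI2 inj_onD)
      then have "(i, k) \<in> I"
        using ijk I unfolding partial_order_on_def preorder_on_def trans_def by blast
      then show "(x, z) \<in> J"
        using ijk unfolding J_iff by blast
    qed
    show "antisym J"
    proof (rule antisymI)
      fix x y assume "(x, y) \<in> J" "(y, x) \<in> J"
      then obtain i j j' i' where ij: "x = f i" "y = f j" "y = f j'" "x = f i'" "(i, j) \<in> I" "(j', i') \<in> I"
        unfolding J_iff by blast
      then have "j = j'" "i = i'"
        using f by (metis FieldI1 FieldI2 inj_onD)+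
      then show "x = y"
        using ij I unfolding partial_order_on_def antisym_def by blast
    qed
  qed
  \<comment> \<open>A copy of the unit category inside \<open>'u\<close>; \<open>undefined\<close>
    merely serves as some element of that type.\<close>
  define D :: "('u, 'u) ordcat" where
    "D = \<lparr>Obj = {undefined}, Arr = {undefined}, Dom = (\<lambda>_. undefined), Cod = (\<lambda>_. undefined),
      Ident = (\<lambda>_. undefined), Comp = (\<lambda>_ _. undefined), Le = (\<lambda>_ _. True)\<rparr>"
  have D_simps: "Obj D = {undefined}" "Ident D d = undefined"
    "Hom D undefined undefined = {undefined}" for d
    unfolding D_def Hom_def by auto
  have cone_iff: "weighted_cone C D (\<lambda>_. S) (\<lambda>_. Ident C S) (\<lambda>_. J) (\<lambda>_ x. x) A a \<longleftrightarrow>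
    A \<in> Obj C \<and> (\<forall>i\<in>Field I. a undefined (f i) \<in> Hom C A S) \<and>
    (\<forall>(i, j)\<in>I. a undefined (f i) \<sqsubseteq> a undefined (f j))" for A a
    unfolding weighted_cone_def D_simps FJ using Ident_Comp by (auto simp: J_def)
  have catD: "ord_category D"
    by unfold_locales (auto simp: D_def Hom_def hom_order_def partial_order_on_def preorder_on_def
        refl_on_def trans_def antisym_def)
  have "\<exists>L l. is_weighted_limit C D (\<lambda>_. S) (\<lambda>_. Ident C S) (\<lambda>_. J) (\<lambda>_ x. x) L l"
  proof (rule lim[unfolded has_weighted_limits_def, rule_format], intro conjI)
    show "small_order_enriched_category \<kappa> D"
      unfolding small_order_enriched_category_def using catD
      by (simp add: D_def small_finite[OF \<kappa>])
    show "order_enriched_functor D C (\<lambda>_. S) (\<lambda>_. Ident C S)"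
      unfolding order_enriched_functor_def using S Ident_Hom[OF S] Comp_Ident[OF Ident_Hom[OF S]]
        le_refl[OF Ident_Hom[OF S]] by auto
    show "weight D (\<lambda>_. J) (\<lambda>_ x. x)"
      using J unfolding weight_def D_simps partial_order_on_def preorder_on_def refl_on_def by auto
    show "\<forall>d\<in>Obj D. small \<kappa> (Field J)"
      using small_image[OF small] unfolding FJ by auto
  qed
  then obtain L l where
    L: "is_weighted_limit C D (\<lambda>_. S) (\<lambda>_. Ident C S) (\<lambda>_. J) (\<lambda>_ x. x) L l"
    by blast
  note L = L[unfolded is_weighted_limit_def cone_iff D_simps FJ]
  have "is_cotensor C I S L (\<lambda>i. l undefined (f i))"
    unfolding is_cotensor_iff
  proof (intro conjI allI impI ballI)
    fix A a
    assume A: "A \<in> Obj C"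
      and a: "(\<forall>i\<in>Field I. a i \<in> Hom C A S) \<and> (\<forall>(i, j)\<in>I. a i \<sqsubseteq> a j)"
    \<comment> \<open>Transports a family indexed by \<open>I\<close> to the copy
      \<open>J\<close>.\<close>
    define b :: "'u \<Rightarrow> 'u \<Rightarrow> _" where "b = (\<lambda>_ x. a (inv_into (Field I) f x))"
    have b: "b d (f i) = a i" if "i \<in> Field I" for d i
      using that f unfolding b_def by simp
    have "\<forall>(i, j)\<in>I. b undefined (f i) \<sqsubseteq> b undefined (f j)"
      using a b by (auto simp: FieldI1 FieldI2)
    then have "\<exists>!t. t \<in> Hom C A L \<and>
        (\<forall>d\<in>{undefined}. \<forall>x\<in>f ` Field I. b d x = l d x \<cdot> t)"
      using L[THEN conjunct2, THEN conjunct1, rule_format, of A b] A a b by auto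
    then show "\<exists>t\<in>Hom C A L. \<forall>i\<in>Field I. a i = l undefined (f i) \<cdot> t"
      using b by auto
  next
    fix A t t'
    assume "t \<in> Hom C A L" "t' \<in> Hom C A L"
      "\<forall>i\<in>Field I. l undefined (f i) \<cdot> t \<sqsubseteq> l undefined (f i) \<cdot> t'"
    then show "t \<sqsubseteq> t'"
      using L[THEN conjunct2, THEN conjunct2, rule_format, of A t t'] Hom_Obj(1)[of t A L] by auto
  qed (use L in auto)
  then show thesis ..
qed

text \<open>An equaliser is the limit of a parallel pair weighted by one-point posets; as a weighted
  limit it comes with an \<open>e\<close> that reflects the order.\<close>

lemma has_order_equalisers:
  fixes \<kappa> :: "'u rel"
  assumes \<kappa>: "universe_cardinal \<kappa>" and lim: "has_weighted_limits \<kappa> C"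
    and \<alpha>: "\<alpha> \<in> Hom C X Y" and \<beta>: "\<beta> \<in> Hom C X Y"
  obtains E e where "e \<in> Hom C E X" "\<alpha> \<cdot> e = \<beta> \<cdot> e"
    "\<And>A h. h \<in> Hom C A X \<Longrightarrow> \<alpha> \<cdot> h = \<beta> \<cdot> h \<Longrightarrow> \<exists>t\<in>Hom C A E. e \<cdot> t = h"
    "\<And>A t t'. t \<in> Hom C A E \<Longrightarrow> t' \<in> Hom C A E \<Longrightarrow> e \<cdot> t \<sqsubseteq> e \<cdot> t' \<Longrightarrow> t \<sqsubseteq> t'"
proof -
  \<comment> \<open>Four distinct elements are used: two objects, which double as their own
    identities, and two parallel arrows.\<close>
  obtain K :: "'u set" where "finite K" "card K = 4"
    using infinite_arbitrarily_large[OF infinite_universe[OF \<kappa>]] by blast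
  then obtain xs :: "'u list" where "distinct xs" "length xs = 4"
    using finite_distinct_list[of K] distinct_card by metis
  then obtain a b f g :: 'u where ds: "distinct [a, b, f, g]"
    by (auto simp: length_Suc_conv eval_nat_numeral)
  \<comment> \<open>The shape with \<open>f\<close> and \<open>g\<close> from \<open>a\<close> to
    \<open>b\<close>. In a composable pair whose first arrow \<open>m\<close> is not
    \<open>a\<close>, the second arrow can only be \<open>b\<close>, so the composite is
    \<open>m\<close>.\<close>
  define D :: "('u, 'u) ordcat" where
    "D = \<lparr>Obj = {a, b}, Arr = {a, b, f, g}, Dom = (\<lambda>m. if m = b then b else a),
      Cod = (\<lambda>m. if m = a then a else b), Ident = (\<lambda>d. d),
      Comp = (\<lambda>n m. if m = a then n else m), Le = (=)\<rparr>"
  define F where "F = (\<lambda>d. if d = a then X else Y)"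
  define Fm where "Fm = (\<lambda>m. if m = a then Ident C X else if m = b then Ident C Y else
    if m = f then \<alpha> else \<beta>)"
  define W :: "'u \<Rightarrow> 'u rel" where "W = (\<lambda>_. {(a, a)})"
  have HomD: "Hom D a a = {a}" "Hom D b b = {b}" "Hom D a b = {f, g}" "Hom D b a = {}"
    using ds unfolding Hom_def D_def by auto
  have ObjD: "Obj D = {a, b}" and IdD: "Ident D d = d"
    and CompD: "n \<cdot>\<^bsub>D\<^esub> m = (if m = a then n else m)" and LeD: "n \<sqsubseteq>\<^bsub>D\<^esub> m \<longleftrightarrow> n = m" for d n m
    unfolding D_def by auto
  have FW: "Field (W d) = {a}" for d
    unfolding W_def by auto
  have XY: "X \<in> Obj C" "Y \<in> Obj C"
    using Hom_Obj[OF \<alpha>] by auto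
  \<comment> \<open>The leg at \<open>b\<close> is forced by the leg at \<open>a\<close>, in two
    ways, so a cone amounts to a morphism into \<open>X\<close> that equalises \<alpha> and
    \<beta>.\<close>
  have cone_iff: "weighted_cone C D F Fm W (\<lambda>_ x. x) A l \<longleftrightarrow>
    l a a \<in> Hom C A X \<and> \<alpha> \<cdot> l a a = l b a \<and> \<beta> \<cdot> l a a = l b a" for A l
  proof -
    have "l b a \<in> Hom C A Y" if "l a a \<in> Hom C A X" "\<alpha> \<cdot> l a a = l b a"
      using Comp_Hom[OF that(1) \<alpha>] that(2) by simp
    then show ?thesis
      unfolding weighted_cone_def ObjD FW using ds Hom_Obj[of "l a a" A X]
        le_refl[of "l a a" A X] le_refl[of "l b a" A Y]
        Ident_Comp[of "l a a" A X] Ident_Comp[of "l b a" A Y]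
      by (auto simp: HomD F_def Fm_def W_def)
  qed
  have catD: "ord_category D"
    by unfold_locales (use ds in \<open>auto simp: D_def Hom_def hom_order_def partial_order_on_def
        preorder_on_def refl_on_def trans_def antisym_def split: if_splits\<close>)
  have "\<exists>L l. is_weighted_limit C D F Fm W (\<lambda>_ x. x) L l"
  proof (rule lim[unfolded has_weighted_limits_def, rule_format], intro conjI)
    show "small_order_enriched_category \<kappa> D"
      unfolding small_order_enriched_category_def using catD
      by (simp add: D_def small_finite[OF \<kappa>])
    show "order_enriched_functor D C F Fm"
      unfolding order_enriched_functor_def ObjD IdD LeD CompD
      using ds XY \<alpha> \<beta> Ident_Hom[OF XY(1)] Ident_Hom[OF XY(2)] Comp_Ident[OF \<alpha>] Comp_Ident[OF \<beta>]
        Ident_Comp[OF \<alpha>] Ident_Comp[OF \<beta>] Ident_Comp[OF Ident_Hom[OF XY(1)]]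
        Ident_Comp[OF Ident_Hom[OF XY(2)]] le_refl[OF \<alpha>] le_refl[OF \<beta>]
        le_refl[OF Ident_Hom[OF XY(1)]] le_refl[OF Ident_Hom[OF XY(2)]]
      by (auto simp: HomD F_def Fm_def)
    show "weight D W (\<lambda>_ x. x)"
      unfolding weight_def by (auto simp: W_def partial_order_on_def preorder_on_def refl_on_def
          trans_def antisym_def)
    show "\<forall>d\<in>Obj D. small \<kappa> (Field (W d))"
      unfolding FW by (simp add: small_finite[OF \<kappa>])
  qed
  then obtain L l where L: "is_weighted_limit C D F Fm W (\<lambda>_ x. x) L l"
    by blast
  note L = L[unfolded is_weighted_limit_def cone_iff ObjD FW]
  have l: "l a a \<in> Hom C L X" "\<alpha> \<cdot> l a a = l b a" "\<beta> \<cdot> l a a = l b a"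
    using L by auto
  show thesis
  proof (rule that[OF l(1)])
    show "\<alpha> \<cdot> l a a = \<beta> \<cdot> l a a"
      using l by simp
    show "\<exists>t\<in>Hom C A L. l a a \<cdot> t = h" if h: "h \<in> Hom C A X" "\<alpha> \<cdot> h = \<beta> \<cdot> h" for A h
      using L[THEN conjunct2, THEN conjunct1, rule_format, of "\<lambda>d _. if d = a then h else \<alpha> \<cdot> h" A]
        h ds by (auto elim!: ex1E)
    show "t \<sqsubseteq> t'" if t: "t \<in> Hom C A L" "t' \<in> Hom C A L" and le: "l a a \<cdot> t \<sqsubseteq> l a a \<cdot> t'" for A t t'
    proof -
      \<comment> \<open>The order clause of the limit also asks for the leg at \<open>b\<close>;
        composing the given inequality with \<alpha> provides it.\<close>
      have "l b a \<cdot> t \<sqsubseteq> l b a \<cdot> t'"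
        using Comp_mono_right[OF Comp_Hom[OF t(1) l(1)] Comp_Hom[OF t(2) l(1)] \<alpha> le]
          Comp_assoc[OF t(1) l(1) \<alpha>] Comp_assoc[OF t(2) l(1) \<alpha>] l(2) by simp
      then show ?thesis
        using L[THEN conjunct2, THEN conjunct2, rule_format, of A t t'] Hom_Obj(1)[of t A L] t le
        by auto
    qed
  qed
qed

text \<open>\<open>is_equaliser\<close> says nothing about the order, so \<open>n\<close> is
  compared with an order-reflecting equaliser \<open>e\<close> of the same pair. From
  \<open>n = e \<cdot> v\<close> and \<open>u \<cdot> v = Ident C X\<close>, an inequality after
  \<open>n\<close> passes to one after \<open>v\<close>, and \<open>u\<close> then cancels
  \<open>v\<close>.\<close>

lemma equaliser_order_monic:
  assumes \<kappa>: "universe_cardinal \<kappa>" and lim: "has_weighted_limits \<kappa> C"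
    and n: "is_equaliser C X Xh Y n \<alpha> \<beta>"
    and t: "t \<in> Hom C A X" "t' \<in> Hom C A X" and le: "n \<cdot> t \<sqsubseteq> n \<cdot> t'"
  shows "t \<sqsubseteq> t'"
proof -
  have \<alpha>\<beta>: "\<alpha> \<in> Hom C Xh Y" "\<beta> \<in> Hom C Xh Y" and nX: "n \<in> Hom C X Xh" and eq: "\<alpha> \<cdot> n = \<beta> \<cdot> n"
    and univ: "\<And>A h. h \<in> Hom C A Xh \<Longrightarrow> \<alpha> \<cdot> h = \<beta> \<cdot> h \<Longrightarrow> \<exists>!t. t \<in> Hom C A X \<and> n \<cdot> t = h"
    using n Hom_Obj(1) unfolding is_equaliser_def by simp_all
  obtain E e where e: "e \<in> Hom C E Xh" "\<alpha> \<cdot> e = \<beta> \<cdot> e"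
    and e_univ: "\<And>A h. h \<in> Hom C A Xh \<Longrightarrow> \<alpha> \<cdot> h = \<beta> \<cdot> h \<Longrightarrow> \<exists>t\<in>Hom C A E. e \<cdot> t = h"
    and e_mono: "\<And>A t t'. t \<in> Hom C A E \<Longrightarrow> t' \<in> Hom C A E \<Longrightarrow> e \<cdot> t \<sqsubseteq> e \<cdot> t' \<Longrightarrow> t \<sqsubseteq> t'"
    by (rule has_order_equalisers[OF \<kappa> lim \<alpha>\<beta>]) (rule that)
  obtain u where u: "u \<in> Hom C E X" "n \<cdot> u = e"
    using univ[OF e] by blast
  obtain v where v: "v \<in> Hom C X E" "e \<cdot> v = n"
    using e_univ[OF nX eq] by blast
  have X: "X \<in> Obj C"
    using Hom_Obj[OF nX] by blast
  \<comment> \<open>Both sides are factorisations of \<open>n\<close> through \<open>n\<close>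
    itself, hence equal by the universal property of \<open>n\<close>.\<close>
  have uv: "u \<cdot> v = Ident C X"
  proof (rule Uniq_D[OF ex1_iff_ex_Uniq[THEN iffD1, OF univ[OF nX eq], THEN conjunct2]])
    show "u \<cdot> v \<in> Hom C X X \<and> n \<cdot> (u \<cdot> v) = n"
      using Comp_Hom[OF v(1) u(1)] Comp_assoc[OF v(1) u(1) nX] u(2) v(2) by simp
    show "Ident C X \<in> Hom C X X \<and> n \<cdot> Ident C X = n"
      using Ident_Hom[OF X] Comp_Ident[OF nX] by simp
  qed
  have "e \<cdot> (v \<cdot> t) \<sqsubseteq> e \<cdot> (v \<cdot> t')"
    using le Comp_assoc[OF t(1) v(1) e(1)] Comp_assoc[OF t(2) v(1) e(1)] v(2) by simp
  then have "v \<cdot> t \<sqsubseteq> v \<cdot> t'"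
    by (rule e_mono[OF Comp_Hom[OF t(1) v(1)] Comp_Hom[OF t(2) v(1)]])
  then have "u \<cdot> (v \<cdot> t) \<sqsubseteq> u \<cdot> (v \<cdot> t')"
    by (rule Comp_mono_right[OF Comp_Hom[OF t(1) v(1)] Comp_Hom[OF t(2) v(1)] u(1)])
  then show ?thesis
    using Comp_assoc[OF t(1) v(1) u(1)] Comp_assoc[OF t(2) v(1) u(1)] uv
      Ident_Comp[OF t(1)] Ident_Comp[OF t(2)] by simp
qed

text \<open>Removes the second cotensor from the definition: tested on the projections
  \<open>\<rho> g\<close>, the equation between \<alpha> and \<beta> becomes a family of equations
  between morphisms into \<open>S\<close>. The last conclusion is
  \<open>equaliser_order_monic\<close>.\<close>

lemma regular_cogenerator_embedding:
  assumes \<kappa>: "universe_cardinal \<kappa>" and lim: "has_weighted_limits \<kappa> C"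
    and S: "regular_cogenerator C S" and X: "X \<in> Obj C"
  obtains Xh \<pi> n where "is_cotensor C (hom_order C X S) S Xh \<pi>" "n \<in> Hom C X Xh"
    "\<And>f. f \<in> Hom C X S \<Longrightarrow> \<pi> f \<cdot> n = f"
    "\<And>A h. h \<in> Hom C A Xh \<Longrightarrow> \<forall>g\<in>Hom C Xh S. g \<cdot> h = \<pi> (g \<cdot> n) \<cdot> h \<Longrightarrow>
      \<exists>t\<in>Hom C A X. n \<cdot> t = h"
    "\<And>A t t'. t \<in> Hom C A X \<Longrightarrow> t' \<in> Hom C A X \<Longrightarrow> n \<cdot> t \<sqsubseteq> n \<cdot> t' \<Longrightarrow> t \<sqsubseteq> t'"
proof -
  obtain Xh \<pi> Y \<rho> n \<alpha> \<beta> where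
    Xh: "is_cotensor C (hom_order C X S) S Xh \<pi>" and Y: "is_cotensor C (hom_order C Xh S) S Y \<rho>"
    and n: "n \<in> Hom C X Xh" "\<forall>f\<in>Hom C X S. \<pi> f \<cdot> n = f"
    and \<alpha>: "\<alpha> \<in> Hom C Xh Y" "\<forall>g\<in>Hom C Xh S. \<rho> g \<cdot> \<alpha> = g"
    and \<beta>: "\<beta> \<in> Hom C Xh Y" "\<forall>g\<in>Hom C Xh S. \<rho> g \<cdot> \<beta> = \<pi> (g \<cdot> n)"
    and eq: "is_equaliser C X Xh Y n \<alpha> \<beta>"
    using S[unfolded regular_cogenerator_def, THEN conjunct2, rule_format, OF X]
    by (elim exE conjE) (rule that)
  show thesis
  proof (rule that[OF Xh n(1)])
    show "\<pi> f \<cdot> n = f" if "f \<in> Hom C X S" for f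
      using n that by blast
    show "t \<sqsubseteq> t'" if "t \<in> Hom C A X" "t' \<in> Hom C A X" "n \<cdot> t \<sqsubseteq> n \<cdot> t'" for A t t'
      using equaliser_order_monic[OF \<kappa> lim eq that] .
    show "\<exists>t\<in>Hom C A X. n \<cdot> t = h"
      if h: "h \<in> Hom C A Xh" and gh: "\<forall>g\<in>Hom C Xh S. g \<cdot> h = \<pi> (g \<cdot> n) \<cdot> h" for A h
    proof -
      have "\<alpha> \<cdot> h = \<beta> \<cdot> h"
      proof (rule cotensor_eq[OF Y Comp_Hom[OF h \<alpha>(1)] Comp_Hom[OF h \<beta>(1)]])
        fix g assume "g \<in> Field (hom_order C Xh S)"
        then have g: "g \<in> Hom C Xh S" and \<rho>: "\<rho> g \<in> Hom C Y S"
          using cotensor_proj_Hom[OF Y] by (auto simp: Field_hom_order)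
        show "\<rho> g \<cdot> (\<alpha> \<cdot> h) = \<rho> g \<cdot> (\<beta> \<cdot> h)"
          using Comp_assoc[OF h \<alpha>(1) \<rho>] Comp_assoc[OF h \<beta>(1) \<rho>] \<alpha>(2) \<beta>(2) g gh by simp
      qed
      then show ?thesis
        using eq h Hom_Obj(1)[OF h] unfolding is_equaliser_def by blast
    qed
  qed
qed

end

section \<open>Cocones\<close>

lemma Hom_op_cat: "Hom (op_cat C) a b = Hom C b a"
  unfolding Hom_def op_cat_def by auto

lemma op_cat_simps:
  "Obj (op_cat C) = Obj C" "Le (op_cat C) = Le C" "Comp (op_cat C) g f = f \<cdot>\<^bsub>C\<^esub> g"
  unfolding op_cat_def by auto

text \<open>A colimit in \<open>C\<close> is by definition a limit in \<open>op_cat C\<close>, so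
  the diagram takes values there; seen from \<open>C\<close> it is contravariant.\<close>

locale weighted_diagram = ord_category C for C :: "('o, 'm) ordcat" (structure) +
  fixes D :: "('d, 'e) ordcat" and F :: "'d \<Rightarrow> 'o" and Fm :: "'e \<Rightarrow> 'm"
    and W :: "'d \<Rightarrow> 'x rel" and Wm :: "'e \<Rightarrow> 'x \<Rightarrow> 'x"
  assumes diagram: "order_enriched_functor D (op_cat C) F Fm"
    and weight: "weight D W Wm"
begin

lemma F_Obj: "d \<in> Obj D \<Longrightarrow> F d \<in> Obj C"
  using diagram unfolding order_enriched_functor_def op_cat_simps by blast

lemma Fm_Hom: "d \<in> Obj D \<Longrightarrow> d' \<in> Obj D \<Longrightarrow> n \<in> Hom D d d' \<Longrightarrow> Fm n \<in> Hom C (F d') (F d)"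
  using diagram unfolding order_enriched_functor_def Hom_op_cat by blast

text \<open>The weight axioms mention related pairs, so the element is viewed as the reflexive pair
  \<open>(x, x)\<close>.\<close>

lemma Wm_Field:
  assumes "d \<in> Obj D" "d' \<in> Obj D" "n \<in> Hom D d d'" "x \<in> Field (W d)"
  shows "Wm n x \<in> Field (W d')"
proof -
  have "(x, x) \<in> W d"
    using weight assms unfolding weight_def partial_order_on_def preorder_on_def refl_on_def by blast
  then have "(Wm n x, Wm n x) \<in> W d'"
    using weight assms unfolding weight_def by blast
  then show ?thesis
    by (rule FieldI1)
qed

abbreviation cocone :: "'o \<Rightarrow> ('d \<Rightarrow> 'x \<Rightarrow> 'm) \<Rightarrow> bool" where
  "cocone \<equiv> weighted_cone (op_cat C) D F Fm W Wm"

lemma coconeI: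
  assumes "A \<in> Obj C"
    and "\<And>d x. d \<in> Obj D \<Longrightarrow> x \<in> Field (W d) \<Longrightarrow> a d x \<in> Hom C (F d) A"
    and "\<And>d x y. d \<in> Obj D \<Longrightarrow> (x, y) \<in> W d \<Longrightarrow> a d x \<sqsubseteq> a d y"
    and "\<And>d d' n x. d \<in> Obj D \<Longrightarrow> d' \<in> Obj D \<Longrightarrow> n \<in> Hom D d d' \<Longrightarrow> x \<in> Field (W d) \<Longrightarrow>
      a d x \<cdot> Fm n = a d' (Wm n x)"
  shows "cocone A a"
  using assms unfolding weighted_cone_def op_cat_simps Hom_op_cat by auto

lemma cocone_Obj: "cocone A a \<Longrightarrow> A \<in> Obj C"
  and cocone_Hom: "cocone A a \<Longrightarrow> d \<in> Obj D \<Longrightarrow> x \<in> Field (W d) \<Longrightarrow> a d x \<in> Hom C (F d) A"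
  and cocone_mono: "cocone A a \<Longrightarrow> d \<in> Obj D \<Longrightarrow> (x, y) \<in> W d \<Longrightarrow> a d x \<sqsubseteq> a d y"
  and cocone_natural: "cocone A a \<Longrightarrow> d \<in> Obj D \<Longrightarrow> d' \<in> Obj D \<Longrightarrow> n \<in> Hom D d d' \<Longrightarrow>
    x \<in> Field (W d) \<Longrightarrow> a d x \<cdot> Fm n = a d' (Wm n x)"
  unfolding weighted_cone_def op_cat_simps Hom_op_cat by auto

lemma cocone_cong:
  assumes a: "cocone A a"
    and eq: "\<And>d x. d \<in> Obj D \<Longrightarrow> x \<in> Field (W d) \<Longrightarrow> b d x = a d x"
  shows "cocone A b"
  using cocone_Obj[OF a] cocone_Hom[OF a] cocone_mono[OF a] cocone_natural[OF a] eq Wm_Field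
  by (intro coconeI) (auto simp: FieldI1 FieldI2)

lemma cocone_Comp:
  assumes a: "cocone A a" and g: "g \<in> Hom C A B"
  shows "cocone B (\<lambda>d x. g \<cdot> a d x)"
proof (rule coconeI)
  show "B \<in> Obj C"
    using Hom_Obj(2)[OF g] .
  show "g \<cdot> a d x \<in> Hom C (F d) B" if "d \<in> Obj D" "x \<in> Field (W d)" for d x
    using Comp_Hom[OF cocone_Hom[OF a that] g] .
  show "g \<cdot> a d x \<sqsubseteq> g \<cdot> a d y" if "d \<in> Obj D" "(x, y) \<in> W d" for d x y
    using Comp_mono_right[OF cocone_Hom[OF a that(1) FieldI1[OF that(2)]]
        cocone_Hom[OF a that(1) FieldI2[OF that(2)]] g cocone_mono[OF a that]] .
  show "g \<cdot> a d x \<cdot> Fm n = g \<cdot> a d' (Wm n x)"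
    if "d \<in> Obj D" "d' \<in> Obj D" "n \<in> Hom D d d'" "x \<in> Field (W d)" for d d' n x
    using Comp_assoc[OF Fm_Hom[OF that(1-3)] cocone_Hom[OF a that(1,4)] g]
      cocone_natural[OF a that] by simp
qed

text \<open>Cocones are made extensional so that the pointwise order on them is antisymmetric.\<close>

definition extensional :: "('d \<Rightarrow> 'x \<Rightarrow> 'm) \<Rightarrow> 'd \<Rightarrow> 'x \<Rightarrow> 'm" where
  "extensional a = (\<lambda>d x. if d \<in> Obj D \<and> x \<in> Field (W d) then a d x else undefined)"

definition cocones :: "'o \<Rightarrow> ('d \<Rightarrow> 'x \<Rightarrow> 'm) set" where
  "cocones A = {p. cocone A p \<and> extensional p = p}"

definition cocone_order :: "'o \<Rightarrow> ('d \<Rightarrow> 'x \<Rightarrow> 'm) rel" where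
  "cocone_order A = {(p, q). p \<in> cocones A \<and> q \<in> cocones A \<and>
    (\<forall>d\<in>Obj D. \<forall>x\<in>Field (W d). p d x \<sqsubseteq> q d x)}"

text \<open>The comparison map from morphisms out of the vertex to cocones. For the colimit cocone
  \<open>l\<close> and target \<open>S\<close> it will turn out to be invertible, with inverse
  \<open>\<lambda>p. \<iota> p \<cdot> c\<close>.\<close>

definition push :: "('d \<Rightarrow> 'x \<Rightarrow> 'm) \<Rightarrow> 'm \<Rightarrow> 'd \<Rightarrow> 'x \<Rightarrow> 'm" where
  "push a g = extensional (\<lambda>d x. g \<cdot> a d x)"

lemma push_apply: "d \<in> Obj D \<Longrightarrow> x \<in> Field (W d) \<Longrightarrow> push a g d x = g \<cdot> a d x"
  unfolding push_def extensional_def by simp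

lemma push_cocones: "cocone A a \<Longrightarrow> g \<in> Hom C A B \<Longrightarrow> push a g \<in> cocones B"
  unfolding cocones_def push_def
  by (auto intro: cocone_cong[OF cocone_Comp] simp: extensional_def fun_eq_iff)

lemma cocones_eqI:
  "p \<in> cocones A \<Longrightarrow> q \<in> cocones A \<Longrightarrow>
    (\<And>d x. d \<in> Obj D \<Longrightarrow> x \<in> Field (W d) \<Longrightarrow> p d x = q d x) \<Longrightarrow> p = q"
  unfolding cocones_def extensional_def fun_eq_iff by (metis (mono_tags, lifting) mem_Collect_eq)

lemma cocones_cocone: "p \<in> cocones A \<Longrightarrow> cocone A p"
  unfolding cocones_def by blast

lemma cocone_order_refl: "p \<in> cocones A \<Longrightarrow> (p, p) \<in> cocone_order A"
  unfolding cocone_order_def using le_refl cocone_Hom[OF cocones_cocone] by blast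

lemma Field_cocone_order: "Field (cocone_order A) = cocones A"
proof
  show "Field (cocone_order A) \<subseteq> cocones A"
    unfolding cocone_order_def Field_def by auto
  show "cocones A \<subseteq> Field (cocone_order A)"
    using cocone_order_refl by (auto intro: FieldI1)
qed

text \<open>The premise compares \<open>g\<close> and \<open>g'\<close> only along the cocone; in
  this form the lemma serves both for monotonicity of \<open>push\<close> and for the order part of
  the universal property.\<close>

lemma push_mono:
  assumes a: "cocone A a" and g: "g \<in> Hom C A B" "g' \<in> Hom C A B"
    and le: "\<And>d x. d \<in> Obj D \<Longrightarrow> x \<in> Field (W d) \<Longrightarrow> g \<cdot> a d x \<sqsubseteq> g' \<cdot> a d x"
  shows "(push a g, push a g') \<in> cocone_order B"
  unfolding cocone_order_def using push_cocones[OF a] g le by (auto simp: push_apply)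

lemma Partial_order_cocone_order: "Partial_order (cocone_order A)"
  unfolding partial_order_on_def preorder_on_def Field_cocone_order
proof (intro conjI)
  show "cocone_order A \<subseteq> cocones A \<times> cocones A"
    unfolding cocone_order_def by auto
  show "refl_on (cocones A) (cocone_order A)"
    unfolding refl_on_def using cocone_order_refl by blast
  show "trans (cocone_order A)"
  proof (rule transI)
    fix p q r assume pqr: "(p, q) \<in> cocone_order A" "(q, r) \<in> cocone_order A"
    then have c: "cocone A p" "cocone A q" "cocone A r"
      unfolding cocone_order_def using cocones_cocone by auto
    have "p d x \<sqsubseteq> r d x" if dx: "d \<in> Obj D" "x \<in> Field (W d)" for d x
      using le_trans[OF cocone_Hom[OF c(1) dx] cocone_Hom[OF c(2) dx] cocone_Hom[OF c(3) dx]]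
        pqr dx unfolding cocone_order_def by blast
    then show "(p, r) \<in> cocone_order A"
      using pqr unfolding cocone_order_def by blast
  qed
  show "antisym (cocone_order A)"
  proof (rule antisymI)
    fix p q assume pq: "(p, q) \<in> cocone_order A" "(q, p) \<in> cocone_order A"
    then have P: "p \<in> cocones A" "q \<in> cocones A"
      unfolding cocone_order_def by auto
    show "p = q"
    proof (rule cocones_eqI[OF P])
      fix d x assume dx: "d \<in> Obj D" "x \<in> Field (W d)"
      show "p d x = q d x"
        using le_antisym[OF cocone_Hom[OF cocones_cocone[OF P(1)] dx]
            cocone_Hom[OF cocones_cocone[OF P(2)] dx]] pq dx
        unfolding cocone_order_def by blast
    qed
  qed
qed

text \<open>An extensional cocone is determined by its graph, and all graphs are subsets of one
  small set \<open>G\<close>, whose power set is small.\<close>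

lemma small_cocones:
  fixes \<kappa> :: "'u rel"
  assumes \<kappa>: "universe_cardinal \<kappa>" and D: "small \<kappa> (Obj D)"
    and W: "\<And>d. d \<in> Obj D \<Longrightarrow> small \<kappa> (Field (W d))"
    and hom: "\<And>a b. a \<in> Obj C \<Longrightarrow> b \<in> Obj C \<Longrightarrow> small \<kappa> (Hom C a b)"
    and A: "A \<in> Obj C"
  shows "small \<kappa> (cocones A)"
proof -
  define G where "G = (SIGMA d:Obj D. Field (W d) \<times> Hom C (F d) A)"
  define graph where "graph = (\<lambda>p :: 'd \<Rightarrow> 'x \<Rightarrow> 'm. {(d, x, p d x) | d x. d \<in> Obj D \<and> x \<in> Field (W d)})"
  have "small \<kappa> G"
    unfolding G_def using W hom F_Obj A by (intro small_Sigma[OF \<kappa>] D) auto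
  moreover have "graph ` cocones A \<subseteq> Pow G"
    unfolding graph_def G_def using cocone_Hom[OF cocones_cocone] by auto
  ultimately have "small \<kappa> (graph ` cocones A)"
    using small_subset[OF small_Pow[OF \<kappa>]] by blast
  moreover have "inj_on graph (cocones A)"
  proof (rule inj_onI)
    fix p q assume P: "p \<in> cocones A" "q \<in> cocones A" and eq: "graph p = graph q"
    show "p = q"
    proof (rule cocones_eqI[OF P])
      fix d x assume "d \<in> Obj D" "x \<in> Field (W d)"
      then have "(d, x, p d x) \<in> graph p"
        unfolding graph_def by blast
      then have "(d, x, p d x) \<in> graph q"
        unfolding eq .
      then show "p d x = q d x"
        unfolding graph_def by blast
    qed
  qed
  ultimately show ?thesis
    using small_inj_on by blast
qed

section \<open>Construction of the colimit\<close>

lemma has_weighted_colimit: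
  fixes \<kappa> :: "'u rel"
  assumes \<kappa>: "universe_cardinal \<kappa>" and D: "small \<kappa> (Obj D)"
    and W: "\<And>d. d \<in> Obj D \<Longrightarrow> small \<kappa> (Field (W d))"
    and hom: "\<And>a b. a \<in> Obj C \<Longrightarrow> b \<in> Obj C \<Longrightarrow> small \<kappa> (Hom C a b)"
    and lim: "has_weighted_limits \<kappa> C" and S: "regular_cogenerator C S"
  shows "\<exists>L l. is_weighted_limit (op_cat C) D F Fm W Wm L l"
proof -

  \<comment> \<open>The cotensor of \<open>S\<close> by the poset of cocones and its canonical
    cocone\<close>
  have S_Obj: "S \<in> Obj C"
    using S unfolding regular_cogenerator_def by blast
  obtain Q \<iota> where Q: "is_cotensor C (cocone_order S) S Q \<iota>"
    using has_cotensors[OF \<kappa> lim S_Obj Partial_order_cocone_order]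
      small_cocones[OF \<kappa> D W hom S_Obj] unfolding Field_cocone_order by blast
  note Q_Obj = cotensor_Obj[OF Q]
  have \<iota>: "\<iota> p \<in> Hom C Q S" if "p \<in> cocones S" for p
    using cotensor_proj_Hom[OF Q] that by (simp add: Field_cocone_order)

  \<comment> \<open>For fixed \<open>d\<close> and \<open>x\<close>, evaluation of cocones at
    \<open>d\<close>, \<open>x\<close> is a monotone family of morphisms into \<open>S\<close>, so
    it lifts to the cotensor.\<close>
  have "\<exists>t\<in>Hom C (F d) Q. \<forall>p\<in>cocones S. \<iota> p \<cdot> t = p d x"
    if dx: "d \<in> Obj D" "x \<in> Field (W d)" for d x
  proof -
    obtain t where "t \<in> Hom C (F d) Q" "\<And>p. p \<in> cocones S \<Longrightarrow> \<iota> p \<cdot> t = p d x"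
    proof (rule cotensor_lift[OF Q F_Obj[OF dx(1)], of "\<lambda>p. p d x", unfolded Field_cocone_order])
      show "p d x \<in> Hom C (F d) S" if "p \<in> cocones S" for p
        using cocone_Hom[OF cocones_cocone[OF that] dx] .
      show "p d x \<sqsubseteq> p' d x" if "(p, p') \<in> cocone_order S" for p p'
        using that dx unfolding cocone_order_def by blast
    qed (rule that)
    then show ?thesis
      by blast
  qed
  then obtain q where q: "\<And>d x. d \<in> Obj D \<Longrightarrow> x \<in> Field (W d) \<Longrightarrow> q d x \<in> Hom C (F d) Q"
    and \<iota>q: "\<And>d x p. d \<in> Obj D \<Longrightarrow> x \<in> Field (W d) \<Longrightarrow> p \<in> cocones S \<Longrightarrow> \<iota> p \<cdot> q d x = p d x"
    by metis
  \<comment> \<open>Each law is checked after every projection \<open>\<iota> p\<close>, where it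
    becomes the same law for the cocone \<open>p\<close>.\<close>
  have q_cocone: "cocone Q q"
  proof (rule coconeI[OF Q_Obj q])
    fix d x y assume d: "d \<in> Obj D" and xy: "(x, y) \<in> W d"
    note x = FieldI1[OF xy] and y = FieldI2[OF xy]
    show "q d x \<sqsubseteq> q d y"
    proof (rule cotensor_le[OF Q q[OF d x] q[OF d y]])
      fix p assume "p \<in> Field (cocone_order S)"
      then have p: "p \<in> cocones S"
        by (simp add: Field_cocone_order)
      show "\<iota> p \<cdot> q d x \<sqsubseteq> \<iota> p \<cdot> q d y"
        using \<iota>q[OF d x p] \<iota>q[OF d y p] cocone_mono[OF cocones_cocone[OF p] d xy] by simp
    qed
  next
    fix d d' n x assume n: "d \<in> Obj D" "d' \<in> Obj D" "n \<in> Hom D d d'" and x: "x \<in> Field (W d)"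
    note Fn = Fm_Hom[OF n] and x' = Wm_Field[OF n x]
    show "q d x \<cdot> Fm n = q d' (Wm n x)"
    proof (rule cotensor_eq[OF Q Comp_Hom[OF Fn q[OF n(1) x]] q[OF n(2) x']])
      fix p assume "p \<in> Field (cocone_order S)"
      then have p: "p \<in> cocones S"
        by (simp add: Field_cocone_order)
      show "\<iota> p \<cdot> (q d x \<cdot> Fm n) = \<iota> p \<cdot> q d' (Wm n x)"
        using Comp_assoc[OF Fn q[OF n(1) x] \<iota>[OF p]] \<iota>q[OF n(1) x p] \<iota>q[OF n(2) x' p]
          cocone_natural[OF cocones_cocone[OF p] n x] by simp
    qed
  qed

  \<comment> \<open>The candidate vertex \<open>L\<close> as an equaliser\<close>
  have \<iota>_mono: "\<iota> p \<sqsubseteq> \<iota> p'" if "(p, p') \<in> cocone_order S" for p p'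
    using cotensor_proj_mono[OF Q that] .
  have push_q: "push q g \<in> cocones S" if "g \<in> Hom C Q S" for g
    using push_cocones[OF q_cocone that] .
  \<comment> \<open>The cotensor \<open>R\<close> bundles all equations between \<open>g\<close> and
    \<open>\<iota> (push q g)\<close> into a single parallel pair \<alpha>, \<beta>;
    \<open>gc\<close> below unbundles them again.\<close>
  obtain R \<rho> where R: "is_cotensor C (hom_order C Q S) S R \<rho>"
    using has_cotensors[OF \<kappa> lim S_Obj, of "hom_order C Q S"] hom[OF Q_Obj S_Obj]
      Hom_poset[OF Q_Obj S_Obj] unfolding Field_hom_order by blast
  have \<rho>: "\<rho> g \<in> Hom C R S" if "g \<in> Hom C Q S" for g
    using cotensor_proj_Hom[OF R] that by (simp add: Field_hom_order)
  obtain \<alpha> where \<alpha>: "\<alpha> \<in> Hom C Q R" "\<And>g. g \<in> Hom C Q S \<Longrightarrow> \<rho> g \<cdot> \<alpha> = g"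
    by (rule cotensor_lift[OF R Q_Obj, of "\<lambda>g. g", unfolded Field_hom_order])
      (auto simp: hom_order_def intro: that)
  obtain \<beta> where \<beta>: "\<beta> \<in> Hom C Q R" "\<And>g. g \<in> Hom C Q S \<Longrightarrow> \<rho> g \<cdot> \<beta> = \<iota> (push q g)"
  proof (rule cotensor_lift[OF R Q_Obj, of "\<lambda>g. \<iota> (push q g)", unfolded Field_hom_order])
    show "\<iota> (push q g) \<in> Hom C Q S" if "g \<in> Hom C Q S" for g
      using \<iota>[OF push_q[OF that]] .
    show "\<iota> (push q g) \<sqsubseteq> \<iota> (push q g')" if "(g, g') \<in> hom_order C Q S" for g g'
    proof -
      have g: "g \<in> Hom C Q S" "g' \<in> Hom C Q S" "g \<sqsubseteq> g'"
        using that unfolding hom_order_def by auto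
      show ?thesis
        by (rule \<iota>_mono, rule push_mono[OF q_cocone g(1,2)], rule Comp_mono_left[OF q g])
    qed
  qed (rule that)
  obtain L c where c: "c \<in> Hom C L Q" "\<alpha> \<cdot> c = \<beta> \<cdot> c"
    and c_univ: "\<And>A h. h \<in> Hom C A Q \<Longrightarrow> \<alpha> \<cdot> h = \<beta> \<cdot> h \<Longrightarrow> \<exists>t\<in>Hom C A L. c \<cdot> t = h"
    and c_mono: "\<And>A t t'. t \<in> Hom C A L \<Longrightarrow> t' \<in> Hom C A L \<Longrightarrow> c \<cdot> t \<sqsubseteq> c \<cdot> t' \<Longrightarrow> t \<sqsubseteq> t'"
    by (rule has_order_equalisers[OF \<kappa> lim \<alpha>(1) \<beta>(1)]) (rule that)
  have L_Obj: "L \<in> Obj C"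
    using Hom_Obj(1)[OF c(1)] .
  have gc: "g \<cdot> c = \<iota> (push q g) \<cdot> c" if g: "g \<in> Hom C Q S" for g
    using Comp_assoc[OF c(1) \<alpha>(1) \<rho>[OF g]] Comp_assoc[OF c(1) \<beta>(1) \<rho>[OF g]] \<alpha>(2)[OF g]
      \<beta>(2)[OF g] c(2) by simp
  have c_monic: "t = t'" if t: "t \<in> Hom C A L" "t' \<in> Hom C A L" and eq: "c \<cdot> t = c \<cdot> t'" for A t t'
    by (rule order_monic_imp_monic[OF c(1) c_mono t eq])

  \<comment> \<open>The cocone on \<open>L\<close>\<close>
  have "\<exists>t\<in>Hom C (F d) L. c \<cdot> t = q d x" if dx: "d \<in> Obj D" "x \<in> Field (W d)" for d x
  proof (rule c_univ[OF q[OF dx]])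
    \<comment> \<open>At \<open>\<rho> g\<close> this compares \<open>g \<cdot> q d x\<close> with
      \<open>\<iota> (push q g) \<cdot> q d x\<close>, which agree by \<open>\<iota>q\<close> for
      the cocone \<open>push q g\<close>.\<close>
    show "\<alpha> \<cdot> q d x = \<beta> \<cdot> q d x"
    proof (rule cotensor_eq[OF R Comp_Hom[OF q[OF dx] \<alpha>(1)] Comp_Hom[OF q[OF dx] \<beta>(1)]])
      fix g assume "g \<in> Field (hom_order C Q S)"
      then have g: "g \<in> Hom C Q S"
        by (simp add: Field_hom_order)
      show "\<rho> g \<cdot> (\<alpha> \<cdot> q d x) = \<rho> g \<cdot> (\<beta> \<cdot> q d x)"
        using Comp_assoc[OF q[OF dx] \<alpha>(1) \<rho>[OF g]] Comp_assoc[OF q[OF dx] \<beta>(1) \<rho>[OF g]]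
          \<alpha>(2)[OF g] \<beta>(2)[OF g] \<iota>q[OF dx push_q[OF g]] push_apply[OF dx, of q g] by simp
    qed
  qed
  then obtain l where l: "\<And>d x. d \<in> Obj D \<Longrightarrow> x \<in> Field (W d) \<Longrightarrow> l d x \<in> Hom C (F d) L"
    and cl: "\<And>d x. d \<in> Obj D \<Longrightarrow> x \<in> Field (W d) \<Longrightarrow> c \<cdot> l d x = q d x"
    by metis
  have l_cocone: "cocone L l"
  proof (rule coconeI[OF L_Obj l])
    fix d x y assume d: "d \<in> Obj D" and xy: "(x, y) \<in> W d"
    note x = FieldI1[OF xy] and y = FieldI2[OF xy]
    show "l d x \<sqsubseteq> l d y"
      by (rule c_mono[OF l[OF d x] l[OF d y]])
        (simp add: cl d x y cocone_mono[OF q_cocone d xy])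
  next
    fix d d' n x assume n: "d \<in> Obj D" "d' \<in> Obj D" "n \<in> Hom D d d'" and x: "x \<in> Field (W d)"
    note Fn = Fm_Hom[OF n] and x' = Wm_Field[OF n x]
    show "l d x \<cdot> Fm n = l d' (Wm n x)"
      by (rule c_monic[OF Comp_Hom[OF Fn l[OF n(1) x]] l[OF n(2) x']])
        (simp add: cl n x x' Comp_assoc[OF Fn l[OF n(1) x] c(1)] cocone_natural[OF q_cocone n x])
  qed

  \<comment> \<open>Factorisation of an arbitrary cocone through \<open>l\<close>\<close>
  have factor: "\<exists>t\<in>Hom C L A. (\<forall>d\<in>Obj D. \<forall>x\<in>Field (W d). t \<cdot> l d x = a d x) \<and>
      (\<forall>s\<in>Hom C A S. s \<cdot> t = \<iota> (push a s) \<cdot> c)"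
    if a: "cocone A a" for A a
  proof -
    have A: "A \<in> Obj C"
      using cocone_Obj[OF a] .
    obtain Ah \<pi> n where Ah: "is_cotensor C (hom_order C A S) S Ah \<pi>" and n: "n \<in> Hom C A Ah"
      and \<pi>n: "\<And>s. s \<in> Hom C A S \<Longrightarrow> \<pi> s \<cdot> n = s"
      and n_univ: "\<And>B h. h \<in> Hom C B Ah \<Longrightarrow> \<forall>g\<in>Hom C Ah S. g \<cdot> h = \<pi> (g \<cdot> n) \<cdot> h \<Longrightarrow>
        \<exists>t\<in>Hom C B A. n \<cdot> t = h"
      and n_mono: "\<And>B t t'. t \<in> Hom C B A \<Longrightarrow> t' \<in> Hom C B A \<Longrightarrow> n \<cdot> t \<sqsubseteq> n \<cdot> t' \<Longrightarrow> t \<sqsubseteq> t'"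
      by (rule regular_cogenerator_embedding[OF \<kappa> lim S A]) (rule that)
    have \<pi>: "\<pi> s \<in> Hom C Ah S" if "s \<in> Hom C A S" for s
      using cotensor_proj_Hom[OF Ah] that by (simp add: Field_hom_order)
    have push_a: "push a s \<in> cocones S" if "s \<in> Hom C A S" for s
      using push_cocones[OF a that] .
    \<comment> \<open>The morphism of cotensors induced by reindexing along the monotone map
      \<open>push a\<close> from \<open>Hom C A S\<close> to the cocones with vertex
      \<open>S\<close>.\<close>
    obtain k where k: "k \<in> Hom C Q Ah" "\<And>s. s \<in> Hom C A S \<Longrightarrow> \<pi> s \<cdot> k = \<iota> (push a s)"
    proof (rule cotensor_lift[OF Ah Q_Obj, of "\<lambda>s. \<iota> (push a s)", unfolded Field_hom_order])
      show "\<iota> (push a s) \<in> Hom C Q S" if "s \<in> Hom C A S" for s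
        using \<iota>[OF push_a[OF that]] .
      show "\<iota> (push a s) \<sqsubseteq> \<iota> (push a s')" if "(s, s') \<in> hom_order C A S" for s s'
      proof -
        have s: "s \<in> Hom C A S" "s' \<in> Hom C A S" "s \<sqsubseteq> s'"
          using that unfolding hom_order_def by auto
        show ?thesis
          by (rule \<iota>_mono, rule push_mono[OF a s(1,2)], rule Comp_mono_left[OF cocone_Hom[OF a] s])
      qed
    qed (rule that)
    have kq: "k \<cdot> q d x = n \<cdot> a d x" if dx: "d \<in> Obj D" "x \<in> Field (W d)" for d x
    proof (rule cotensor_eq[OF Ah Comp_Hom[OF q[OF dx] k(1)] Comp_Hom[OF cocone_Hom[OF a dx] n]])
      fix s assume "s \<in> Field (hom_order C A S)"
      then have s: "s \<in> Hom C A S"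
        by (simp add: Field_hom_order)
      show "\<pi> s \<cdot> (k \<cdot> q d x) = \<pi> s \<cdot> (n \<cdot> a d x)"
        using Comp_assoc[OF q[OF dx] k(1) \<pi>[OF s]] Comp_assoc[OF cocone_Hom[OF a dx] n \<pi>[OF s]]
          k(2)[OF s] \<pi>n[OF s] \<iota>q[OF dx push_a[OF s]] push_apply[OF dx, of a s] by simp
    qed
    have kc: "k \<cdot> c \<in> Hom C L Ah"
      using Comp_Hom[OF c(1) k(1)] .
    have \<pi>kc: "\<pi> s \<cdot> (k \<cdot> c) = \<iota> (push a s) \<cdot> c" if s: "s \<in> Hom C A S" for s
      using Comp_assoc[OF c(1) k(1) \<pi>[OF s]] k(2)[OF s] by simp
    have "\<exists>t\<in>Hom C L A. n \<cdot> t = k \<cdot> c"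
    proof (rule n_univ[OF kc], rule ballI)
      fix g assume g: "g \<in> Hom C Ah S"
      have gk: "g \<cdot> k \<in> Hom C Q S" and gn: "g \<cdot> n \<in> Hom C A S"
        using Comp_Hom[OF k(1) g] Comp_Hom[OF n g] .
      \<comment> \<open>With this identity, \<open>gc\<close> at \<open>g \<cdot> k\<close> is
        exactly the condition under which \<open>k \<cdot> c\<close> factors through
        \<open>n\<close>.\<close>
      have "push q (g \<cdot> k) = push a (g \<cdot> n)"
      proof (rule cocones_eqI[OF push_q[OF gk] push_a[OF gn]])
        fix d x assume dx: "d \<in> Obj D" "x \<in> Field (W d)"
        show "push q (g \<cdot> k) d x = push a (g \<cdot> n) d x"
          using Comp_assoc[OF q[OF dx] k(1) g] Comp_assoc[OF cocone_Hom[OF a dx] n g] kq[OF dx]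
          by (simp add: push_apply dx)
      qed
      then show "g \<cdot> (k \<cdot> c) = \<pi> (g \<cdot> n) \<cdot> (k \<cdot> c)"
        using Comp_assoc[OF c(1) k(1) g] gc[OF gk] \<pi>kc[OF gn] by simp
    qed
    then obtain t where t: "t \<in> Hom C L A" and nt: "n \<cdot> t = k \<cdot> c"
      by blast
    have n_monic: "u = u'" if u: "u \<in> Hom C B A" "u' \<in> Hom C B A" and eq: "n \<cdot> u = n \<cdot> u'" for B u u'
      by (rule order_monic_imp_monic[OF n n_mono u eq])
    \<comment> \<open>After the monic \<open>n\<close> the left side becomes
      \<open>k \<cdot> c \<cdot> l d x\<close>, that is \<open>k \<cdot> q d x\<close>, and
      \<open>kq\<close> applies.\<close>
    have "t \<cdot> l d x = a d x" if dx: "d \<in> Obj D" "x \<in> Field (W d)" for d x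
      by (rule n_monic[OF Comp_Hom[OF l[OF dx] t] cocone_Hom[OF a dx]])
        (simp add: Comp_assoc[OF l[OF dx] t n] nt Comp_assoc[OF l[OF dx] c(1) k(1), symmetric]
          cl[OF dx] kq[OF dx])
    moreover have "s \<cdot> t = \<iota> (push a s) \<cdot> c" if s: "s \<in> Hom C A S" for s
      using \<pi>n[OF s] Comp_assoc[OF t n \<pi>[OF s]] nt \<pi>kc[OF s] by simp
    ultimately show ?thesis
      using t by blast
  qed

  \<comment> \<open>Morphisms from \<open>L\<close> to \<open>S\<close> are determined by their
    restriction to \<open>l\<close>\<close>
  have rep: "s = \<iota> (push l s) \<cdot> c" if s: "s \<in> Hom C L S" for s
  proof -
    \<comment> \<open>Here \<open>l\<close> is factored through itself. Uniqueness of factorisations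
      is not yet available, so \<open>e\<close> is identified with the identity by means of the
      monic \<open>c\<close>.\<close>
    obtain e where e: "e \<in> Hom C L L" and se: "\<And>s. s \<in> Hom C L S \<Longrightarrow> s \<cdot> e = \<iota> (push l s) \<cdot> c"
      using factor[OF l_cocone] by blast
    have "c \<cdot> e = c"
    proof (rule cotensor_eq[OF Q Comp_Hom[OF e c(1)] c(1)])
      fix p assume "p \<in> Field (cocone_order S)"
      then have p: "p \<in> cocones S"
        by (simp add: Field_cocone_order)
      note \<iota>c = Comp_Hom[OF c(1) \<iota>[OF p]]
      \<comment> \<open>Hence \<open>se\<close> at \<open>\<iota> p \<cdot> c\<close> returns this
        same morphism, so \<open>e\<close> is invisible after every component of
        \<open>c\<close>.\<close>
      have "push l (\<iota> p \<cdot> c) = p"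
      proof (rule cocones_eqI[OF push_cocones[OF l_cocone \<iota>c] p])
        fix d x assume dx: "d \<in> Obj D" "x \<in> Field (W d)"
        show "push l (\<iota> p \<cdot> c) d x = p d x"
          using Comp_assoc[OF l[OF dx] c(1) \<iota>[OF p]] cl[OF dx] \<iota>q[OF dx p]
          by (simp add: push_apply dx)
      qed
      then show "\<iota> p \<cdot> (c \<cdot> e) = \<iota> p \<cdot> c"
        using Comp_assoc[OF e c(1) \<iota>[OF p]] se[OF \<iota>c] by simp
    qed
    then have "e = Ident C L"
      using c_monic[OF e Ident_Hom[OF L_Obj]] Comp_Ident[OF c(1)] by simp
    then show ?thesis
      using se[OF s] Comp_Ident[OF s] by simp
  qed

  \<comment> \<open>The universal property of \<open>L\<close>\<close>
  interpret op: ord_category "op_cat C"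
    by (rule ord_category_op_cat)
  have "is_weighted_limit (op_cat C) D F Fm W Wm L l"
  proof (rule op.is_weighted_limitI[OF l_cocone])
    show "\<exists>t\<in>Hom (op_cat C) A L. \<forall>d\<in>Obj D. \<forall>x\<in>Field (W d). a d x = l d x \<cdot>\<^bsub>op_cat C\<^esub> t"
      if "cocone A a" for A a
      using factor[OF that] unfolding Hom_op_cat op_cat_simps by force
  next
    fix A t t' assume "t \<in> Hom (op_cat C) A L" "t' \<in> Hom (op_cat C) A L"
      and "\<And>d x. d \<in> Obj D \<Longrightarrow> x \<in> Field (W d) \<Longrightarrow>
        l d x \<cdot>\<^bsub>op_cat C\<^esub> t \<sqsubseteq>\<^bsub>op_cat C\<^esub> l d x \<cdot>\<^bsub>op_cat C\<^esub> t'"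
    then have t: "t \<in> Hom C L A" "t' \<in> Hom C L A"
      and le: "\<And>d x. d \<in> Obj D \<Longrightarrow> x \<in> Field (W d) \<Longrightarrow> t \<cdot> l d x \<sqsubseteq> t' \<cdot> l d x"
      unfolding Hom_op_cat op_cat_simps by auto
    obtain Ah \<pi> n where Ah: "is_cotensor C (hom_order C A S) S Ah \<pi>" and n: "n \<in> Hom C A Ah"
      and \<pi>n: "\<And>s. s \<in> Hom C A S \<Longrightarrow> \<pi> s \<cdot> n = s"
      and n_mono: "\<And>B t t'. t \<in> Hom C B A \<Longrightarrow> t' \<in> Hom C B A \<Longrightarrow> n \<cdot> t \<sqsubseteq> n \<cdot> t' \<Longrightarrow> t \<sqsubseteq> t'"
      by (rule regular_cogenerator_embedding[OF \<kappa> lim S Hom_Obj(2)[OF t(1)]]) (rule that)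
    have "t \<sqsubseteq> t'"
    \<comment> \<open>Since \<open>n\<close> reflects the order and the projections of
      \<open>Ah\<close> do so jointly, it suffices to compare \<open>s \<cdot> t\<close> with
      \<open>s \<cdot> t'\<close> for all \<open>s\<close> into \<open>S\<close>.\<close>
    proof (rule n_mono[OF t], rule cotensor_le[OF Ah Comp_Hom[OF t(1) n] Comp_Hom[OF t(2) n]])
      fix s assume "s \<in> Field (hom_order C A S)"
      then have s: "s \<in> Hom C A S"
        by (simp add: Field_hom_order)
      have \<pi>: "\<pi> s \<in> Hom C Ah S"
        using cotensor_proj_Hom[OF Ah] s by (simp add: Field_hom_order)
      note st = Comp_Hom[OF t(1) s] and st' = Comp_Hom[OF t(2) s]
      \<comment> \<open>The assumption on the legs orders the restricted cocones; monotonicity of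
        \<iota> together with \<open>rep\<close> lifts this to the morphisms.\<close>
      have "(push l (s \<cdot> t), push l (s \<cdot> t')) \<in> cocone_order S"
      proof (rule push_mono[OF l_cocone st st'])
        fix d x assume dx: "d \<in> Obj D" "x \<in> Field (W d)"
        show "s \<cdot> t \<cdot> l d x \<sqsubseteq> s \<cdot> t' \<cdot> l d x"
          using Comp_mono_right[OF Comp_Hom[OF l[OF dx] t(1)] Comp_Hom[OF l[OF dx] t(2)] s le[OF dx]]
            Comp_assoc[OF l[OF dx] t(1) s] Comp_assoc[OF l[OF dx] t(2) s] by simp
      qed
      then have "\<iota> (push l (s \<cdot> t)) \<cdot> c \<sqsubseteq> \<iota> (push l (s \<cdot> t')) \<cdot> c"
        using Comp_mono_left[OF c(1) \<iota>[OF push_cocones[OF l_cocone st]]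
            \<iota>[OF push_cocones[OF l_cocone st']] \<iota>_mono] by blast
      then have "s \<cdot> t \<sqsubseteq> s \<cdot> t'"
        using rep[OF st] rep[OF st'] by simp
      then show "\<pi> s \<cdot> (n \<cdot> t) \<sqsubseteq> \<pi> s \<cdot> (n \<cdot> t')"
        using Comp_assoc[OF t(1) n \<pi>] Comp_assoc[OF t(2) n \<pi>] \<pi>n[OF s] by simp
    qed
    then show "t \<sqsubseteq>\<^bsub>op_cat C\<^esub> t'"
      unfolding op_cat_simps .
  qed
  then show ?thesis
    by blast
qed

end

theorem theorem4p5:
  fixes \<kappa> :: "'u rel" and C :: "('o, 'm) ordcat"
  assumes "universe_cardinal \<kappa>"
    and "order_enriched_category \<kappa> C"
    and "has_weighted_limits \<kappa> C"
    and "\<exists>S. regular_cogenerator C S"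
  shows "has_weighted_colimits \<kappa> C"
proof -
  have C: "ord_category C"
    and hom: "\<And>a b. a \<in> Obj C \<Longrightarrow> b \<in> Obj C \<Longrightarrow> small \<kappa> (Hom C a b)"
    using assms(2) unfolding order_enriched_category_def by auto
  obtain S where S: "regular_cogenerator C S"
    using assms(4) by blast
  show ?thesis
    unfolding has_weighted_colimits_def has_weighted_limits_def
  proof (intro allI impI, elim conjE)
    fix D :: "('u, 'u) ordcat" and F Fm and W :: "'u \<Rightarrow> 'u rel" and Wm
    assume D: "small_order_enriched_category \<kappa> D"
      and F: "order_enriched_functor D (op_cat C) F Fm" and W: "weight D W Wm"
      and small: "\<forall>d\<in>Obj D. small \<kappa> (Field (W d))"
    interpret weighted_diagram C D F Fm W Wm
      by (intro weighted_diagram.intro weighted_diagram_axioms.intro C F W)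
    show "\<exists>L l. is_weighted_limit (op_cat C) D F Fm W Wm L l"
    proof (rule has_weighted_colimit[OF assms(1) _ _ hom assms(3) S])
      show "small \<kappa> (Obj D)"
        using D unfolding small_order_enriched_category_def by blast
    qed (use small in blast)
  qed
qed

end
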